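(* Let $\mathcal D\subset\mathbb R^d$ be compact and $\mathbf A,\mathbf A_1,\mathbf A_2,\dots$ IID random closed sets with $\partial\mathbf A\ne\emptyset$ a.s. Suppose $E[b_{\mathbf A}(x_0)^2]<\infty$ for some $x_0\in\mathcal D$. Then $$\mathbb Z_n(x)=\sqrt n\big(\bar b_n(x)-E[b_{\mathbf A}(x)]\big),\qquad \bar b_n=\tfrac1n\textstyle\sum_{i=1}^n b_{\mathbf A_i},$$ converges weakly in $C(\mathcal D)$ to a mean-zero Gaussian random field $\mathbb Z$ with continuous sample paths and covariance $\mathrm{cov}(\mathbb Z(x),\mathbb Z(y))=E[b_{\mathbf A}(x)b_{\mathbf A}(y)]-E[b_{\mathbf A}(x)]E[b_{\mathbf A}(y)]$, $x,y\in\mathcal D$.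
   Context: Complements and boundaries are relative to $\mathcal D$. For nonempty $A\subset\mathcal D$, $d_A(x)=\inf_{y\in A}|x-y|$; for $A$ with $\partial A\ne\emptyset$, $b_A=d_A-d_{A^c}$ on $\mathcal D$ (oriented distance function). A random closed set is a map into closed subsets of $\mathcal D$ with $\{\mathbf A\cap K\ne\emptyset\}$ measurable for every compact $K$; random closed sets are IID if their oriented distance functions are IID random functions on $\mathcal D$. $C(\mathcal D)$ carries the uniform metric. *)

theory Defs
  imports "HOL-Probability.Probability"
begin

definition rel_boundary :: "'a::metric_space set \<Rightarrow> 'a set \<Rightarrow> 'a set" where
  "rel_boundary D A = D \<inter> closure A \<inter> closure (D - A)"

definition oriented_dist :: "'a::metric_space set \<Rightarrow> 'a set \<Rightarrow> 'a \<Rightarrow> real" where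
  "oriented_dist D A x = infdist x A - infdist x (D - A)"

definition random_closed_set :: "'w measure \<Rightarrow> 'a::metric_space set \<Rightarrow> ('w \<Rightarrow> 'a set) \<Rightarrow> bool" where
  "random_closed_set M D A \<longleftrightarrow>
     (\<forall>\<omega>\<in>space M. closed (A \<omega>) \<and> A \<omega> \<subseteq> D) \<and>
     (\<forall>K. compact K \<longrightarrow> {\<omega>\<in>space M. A \<omega> \<inter> K \<noteq> {}} \<in> sets M)"

definition CD :: "'a::metric_space set \<Rightarrow> ('a \<Rightarrow> real) set" where
  "CD D = {f. f \<in> extensional D \<and> continuous_on D f}"

definition sup_dist :: "'a set \<Rightarrow> ('a \<Rightarrow> real) \<Rightarrow> ('a \<Rightarrow> real) \<Rightarrow> real" where
  "sup_dist D f g = (SUP x\<in>D. \<bar>f x - g x\<bar>)"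

definition sup_open :: "'a::metric_space set \<Rightarrow> ('a \<Rightarrow> real) set \<Rightarrow> bool" where
  "sup_open D U \<longleftrightarrow> U \<subseteq> CD D \<and>
     (\<forall>f\<in>U. \<exists>e>0. \<forall>g\<in>CD D. sup_dist D f g < e \<longrightarrow> g \<in> U)"

definition borel_CD :: "'a::metric_space set \<Rightarrow> ('a \<Rightarrow> real) measure" where
  "borel_CD D = sigma (CD D) {U. sup_open D U}"

definition bounded_cont_CD :: "'a::metric_space set \<Rightarrow> (('a \<Rightarrow> real) \<Rightarrow> real) \<Rightarrow> bool" where
  "bounded_cont_CD D F \<longleftrightarrow>
     (\<exists>B. \<forall>f\<in>CD D. \<bar>F f\<bar> \<le> B) \<and>
     (\<forall>f\<in>CD D. \<forall>e>0. \<exists>\<delta>>0. \<forall>g\<in>CD D. sup_dist D f g < \<delta> \<longrightarrow> \<bar>F g - F f\<bar> < e)"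

definition weak_conv_CD ::
  "'a::metric_space set \<Rightarrow> (nat \<Rightarrow> ('a \<Rightarrow> real) measure) \<Rightarrow> ('a \<Rightarrow> real) measure \<Rightarrow> bool" where
  "weak_conv_CD D \<mu>s \<mu> \<longleftrightarrow>
     (\<forall>F. bounded_cont_CD D F \<longrightarrow> (\<lambda>n. \<integral>f. F f \<partial>(\<mu>s n)) \<longlonglongrightarrow> (\<integral>f. F f \<partial>\<mu>))"

definition gaussian_law :: "real \<Rightarrow> real \<Rightarrow> real measure" where
  "gaussian_law m v = (if v = 0 then return borel m else density lborel (normal_density m (sqrt v)))"

definition gaussian_field_law :: "'a set \<Rightarrow> ('a \<Rightarrow> real) measure \<Rightarrow> bool" where
  "gaussian_field_law D \<mu> \<longleftrightarrow>
     (\<forall>S c. finite S \<longrightarrow> S \<subseteq> D \<longrightarrow>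
        (\<exists>m v. v \<ge> 0 \<and> distr \<mu> borel (\<lambda>f. \<Sum>x\<in>S. c x * f x) = gaussian_law m v))"

end

(* The oriented distance functions are 2-Lipschitz and bounded by the diameter of D, whatever the sets
   are, so this is a central limit theorem for bounded Lipschitz fields over a compact subset of a
   Euclidean space. By Hoeffding's inequality the increments of Z_n are subgaussian with constants
   independent of n; chaining along dyadic grids then puts Z_n, with probability close to 1 uniformly
   in n, into a set of equicontinuous functions that is compact for pointwise convergence. On such a
   set Stone-Weierstrass approximates a bounded continuous functional by trigonometric polynomials in
   finitely many coordinates, for which convergence is the one-dimensional central limit theorem
   (Cramer-Wold). The limit field is built from independent standard normals by a Cholesky
   factorisation of the covariance over a countable dense set, and extended by the same chaining. *)

theory Submission
  imports Defs
begin

section \<open>Functions with the product topology\<close>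

text \<open>Second moments would bound the chance of a large increment on one link of level
  \<open>k\<close> only by a multiple of \<open>(4/9) ^ k\<close>, which in higher dimension loses
  against the number of links; the exponential tails of Hoeffding's inequality win in every
  dimension. They have exactly the form of the tails of a centred Gaussian whose variance is at most
  the square of the bound on the summands. The fields \<open>Z_n\<close> and the limit therefore
  satisfy the same estimates with the same constants, and one chaining argument serves both to
  extend the Gaussian family from a countable set and to confine all the laws to a common compact
  set. No subsequence of laws is extracted: the limit is constructed beforehand and integrals are
  compared directly. The compact sets live in the space of all functions with the product topology,
  where compactness is Tychonoff's theorem and coordinates are continuous; the uniform metric is
  recovered because on equicontinuous sets closeness on a fine finite net forces uniform
  closeness.\<close>

lemma open_coordinate_vimage: "open W \<Longrightarrow> open ((\<lambda>h. h x) -` W :: ('a \<Rightarrow> 'b::topological_space) set)"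
  by (simp add: open_vimage)

text \<open>The separation axioms are climbed up to Hausdorff because
  \<open>function_ring_on\<close>, the setting of the Stone-Weierstrass theorem applied below, asks
  for a \<open>t2_space\<close>.\<close>

instance "fun" :: (type, t0_space) t0_space
proof
  fix f g :: "'a \<Rightarrow> 'b" assume "f \<noteq> g"
  then obtain x where "f x \<noteq> g x" by blast
  then obtain U where "open U" "(f x \<in> U) \<noteq> (g x \<in> U)"
    using t0_space_class.t0_space by metis
  then show "\<exists>U. open U \<and> (f \<in> U) \<noteq> (g \<in> U)"
    by (intro exI[of _ "(\<lambda>h. h x) -` U"]) (auto simp: open_coordinate_vimage)
qed

instance "fun" :: (type, t1_space) t1_space
proof
  fix f g :: "'a \<Rightarrow> 'b" assume "f \<noteq> g"
  then obtain x where "f x \<noteq> g x" by blast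
  then obtain U where "open U" "f x \<in> U" "g x \<notin> U"
    using t1_space_class.t1_space by metis
  then show "\<exists>U. open U \<and> f \<in> U \<and> g \<notin> U"
    by (intro exI[of _ "(\<lambda>h. h x) -` U"]) (auto simp: open_coordinate_vimage)
qed

instance "fun" :: (type, t2_space) t2_space
proof
  fix f g :: "'a \<Rightarrow> 'b" assume "f \<noteq> g"
  then obtain x where "f x \<noteq> g x" by blast
  then obtain U V where UV: "open U" "open V" "f x \<in> U" "g x \<in> V" "U \<inter> V = {}"
    using hausdorff by metis
  show "\<exists>U V. open U \<and> open V \<and> f \<in> U \<and> g \<in> V \<and> U \<inter> V = {}"
    by (rule exI[of _ "(\<lambda>h. h x) -` U"], rule exI[of _ "(\<lambda>h. h x) -` V"])
      (use UV in \<open>auto simp: open_coordinate_vimage\<close>)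
qed

section \<open>Dyadic grids\<close>

text \<open>Restricting to \<open>Basis\<close> puts the occupied cells into a \<open>PiE\<close>
  over finitely many directions, where they can be counted.\<close>

definition grid_cell :: "nat \<Rightarrow> 'a::euclidean_space \<Rightarrow> 'a \<Rightarrow> int" where
  "grid_cell k x = (\<lambda>b\<in>Basis. \<lfloor>2 ^ k * (x \<bullet> b)\<rfloor>)"

lemma dist_le_same_grid_cell:
  fixes x y :: "'a::euclidean_space"
  assumes "grid_cell k x = grid_cell k y"
  shows "dist x y \<le> real DIM('a) / 2 ^ k"
proof -
  have *: "\<bar>(x - y) \<bullet> b\<bar> \<le> 1 / 2 ^ k" if "b \<in> Basis" for b
  proof -
    have "\<lfloor>2 ^ k * (x \<bullet> b)\<rfloor> = \<lfloor>2 ^ k * (y \<bullet> b)\<rfloor>"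
      using fun_cong[OF assms, of b] that by (simp add: grid_cell_def)
    then have "\<bar>2 ^ k * (x \<bullet> b) - 2 ^ k * (y \<bullet> b)\<bar> \<le> 1" by linarith
    then have "2 ^ k * \<bar>(x - y) \<bullet> b\<bar> \<le> 1"
      by (simp add: inner_diff_left abs_mult flip: right_diff_distrib)
    then show ?thesis by (simp add: field_simps)
  qed
  have "dist x y \<le> (\<Sum>b\<in>Basis. \<bar>(x - y) \<bullet> b\<bar>)"
    unfolding dist_norm by (rule norm_le_l1)
  also have "\<dots> \<le> (\<Sum>b\<in>(Basis::'a set). 1 / 2 ^ k)" by (intro sum_mono *)
  finally show ?thesis by simp
qed

locale compact_index =
  fixes D :: "'a::euclidean_space set"
  assumes compact_D: "compact D" and D_nonempty: "D \<noteq> {}"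
begin

text \<open>A representative inside \<open>D\<close> is chosen for every occupied cell, since the
  fields only make sense on \<open>D\<close>. The resulting nets need not be nested, so points of
  one net have to be linked to those of the next.\<close>

definition proj :: "nat \<Rightarrow> 'a \<Rightarrow> 'a" where
  "proj k x = inv_into D (grid_cell k) (grid_cell k x)"

definition net :: "nat \<Rightarrow> 'a set" where "net k = proj k ` D"

definition mesh :: "nat \<Rightarrow> real" where "mesh k = real DIM('a) / 2 ^ k"

definition skel :: "'a set" where "skel = (\<Union>k. net k)"

lemma proj_in_D: "x \<in> D \<Longrightarrow> proj k x \<in> D"
  unfolding proj_def by (intro inv_into_into) auto

lemma proj_in_net: "x \<in> D \<Longrightarrow> proj k x \<in> net k"
  by (auto simp: net_def)

lemma net_subset: "net k \<subseteq> D"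
  by (auto simp: net_def proj_in_D)

lemma skel_subset: "skel \<subseteq> D"
  using net_subset by (auto simp: skel_def)

lemma net_in_skel: "u \<in> net k \<Longrightarrow> u \<in> skel"
  by (auto simp: skel_def)

lemma mesh_pos: "0 < mesh k"
  by (simp add: mesh_def)

lemma mesh_Suc: "mesh (Suc k) = mesh k / 2"
  by (simp add: mesh_def)

lemma mesh_tendsto_0: "mesh \<longlonglongrightarrow> 0"
proof -
  have "(\<lambda>k. real DIM('a) * (1/2) ^ k) \<longlonglongrightarrow> real DIM('a) * 0"
    by (intro tendsto_intros) auto
  then show ?thesis by (simp add: mesh_def[abs_def] power_divide)
qed

lemma ex_mesh_less: "0 < e \<Longrightarrow> \<exists>k\<ge>m. mesh k < e"
  using order_tendstoD(2)[OF mesh_tendsto_0, of e] unfolding eventually_sequentially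
  by (metis max.cobounded1 max.cobounded2)

lemma dist_proj_le: "x \<in> D \<Longrightarrow> dist (proj k x) x \<le> mesh k"
  unfolding mesh_def proj_def by (intro dist_le_same_grid_cell f_inv_into_f) auto

lemma proj_tendsto: "x \<in> D \<Longrightarrow> (\<lambda>k. proj k x) \<longlonglongrightarrow> x"
  by (rule metric_tendsto_imp_tendsto[OF mesh_tendsto_0])
    (auto intro!: always_eventually simp: dist_proj_le less_imp_le[OF mesh_pos])

lemma continuous_proj_tendsto:
  "continuous_on D f \<Longrightarrow> x \<in> D \<Longrightarrow> (\<lambda>k. f (proj k x)) \<longlonglongrightarrow> f x"
  by (rule continuous_on_tendsto_compose[OF _ proj_tendsto]) (auto simp: proj_in_D)

lemma card_net_le: "\<exists>C>0. \<forall>k. finite (net k) \<and> real (card (net k)) \<le> C * (2 ^ DIM('a)) ^ k"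
proof -
  obtain B where B: "\<And>x. x \<in> D \<Longrightarrow> norm x \<le> B"
    using compact_imp_bounded[OF compact_D] by (auto simp: bounded_iff)
  \<comment> \<open>One unit beyond the bound on the coordinates; after scaling by
    \<open>2 ^ k\<close> it leaves room for the rounding by the floor.\<close>
  define L where "L = nat \<lceil>B\<rceil> + 1"
  have fc: "finite (net k)" and card: "real (card (net k)) \<le> real ((2 * L + 1) ^ DIM('a)) * (2 ^ DIM('a)) ^ k" for k
  proof -
    define I where "I = {- int (L * 2 ^ k) .. int (L * 2 ^ k)}"
    have sub: "grid_cell k ` D \<subseteq> (\<Pi>\<^sub>E b\<in>Basis. I)"
    proof (rule image_subsetI)
      fix x assume x: "x \<in> D"
      have "\<lfloor>2 ^ k * (x \<bullet> b)\<rfloor> \<in> I" if b: "b \<in> Basis" for b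
      proof -
        have "\<bar>x \<bullet> b\<bar> \<le> norm x" using b by (rule Basis_le_norm)
        also have "\<dots> \<le> B" using B x by auto
        also have "\<dots> \<le> real L - 1" unfolding L_def by linarith
        finally have "2 ^ k * \<bar>x \<bullet> b\<bar> \<le> 2 ^ k * (real L - 1)" by (rule mult_left_mono) auto
        then have "\<bar>2 ^ k * (x \<bullet> b)\<bar> \<le> real (L * 2 ^ k) - 1"
          using one_le_power[of "2::real" k]
          by (simp add: abs_mult algebra_simps del: one_le_power)
        then have "- int (L * 2 ^ k) \<le> \<lfloor>2 ^ k * (x \<bullet> b)\<rfloor>" "\<lfloor>2 ^ k * (x \<bullet> b)\<rfloor> \<le> int (L * 2 ^ k)"
          by linarith+
        then show ?thesis unfolding I_def by auto
      qed
      then show "grid_cell k x \<in> (\<Pi>\<^sub>E b\<in>Basis. I)" by (auto simp: grid_cell_def)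
    qed
    have finI: "finite (\<Pi>\<^sub>E b\<in>(Basis::'a set). I)" by (intro finite_PiE) (auto simp: I_def)
    have net: "net k = inv_into D (grid_cell k) ` (grid_cell k ` D)"
      by (auto simp: net_def proj_def image_image)
    show "finite (net k)" unfolding net by (intro finite_imageI finite_subset[OF sub finI])
    have "card (net k) \<le> card (grid_cell k ` D)"
      unfolding net by (intro card_image_le finite_subset[OF sub finI])
    also have "\<dots> \<le> card (\<Pi>\<^sub>E b\<in>(Basis::'a set). I)" by (intro card_mono finI sub)
    also have "\<dots> = card I ^ DIM('a)" by (simp add: card_PiE)
    also have "card I = 2 * L * 2 ^ k + 1"
    proof -
      have "card {- int N .. int N} = 2 * N + 1" for N by (simp add: nat_eq_iff)
      from this[of "L * 2 ^ k"] show ?thesis by (simp add: I_def)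
    qed
    also have "(2 * L * 2 ^ k + 1) ^ DIM('a) \<le> ((2 * L + 1) * 2 ^ k) ^ DIM('a)"
      by (intro power_mono) (auto simp: algebra_simps)
    also have "\<dots> = (2 * L + 1) ^ DIM('a) * (2 ^ DIM('a)) ^ k"
      by (simp only: power_mult_distrib power_mult[symmetric] mult.commute[of k])
    finally have "real (card (net k)) \<le> real ((2 * L + 1) ^ DIM('a) * (2 ^ DIM('a)) ^ k)"
      by (rule of_nat_mono)
    then show "real (card (net k)) \<le> real ((2 * L + 1) ^ DIM('a)) * (2 ^ DIM('a)) ^ k" by simp
  qed
  show ?thesis
    by (rule exI[of _ "real ((2 * L + 1) ^ DIM('a))"]) (use fc card in auto)
qed

lemma finite_net: "finite (net k)"
  using card_net_le by blast

lemma countable_skel: "countable skel"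
  unfolding skel_def by (simp add: countable_finite finite_net)

section \<open>Chaining along the grids\<close>

text \<open>The factor 3 covers both kinds of step in the chaining: grid points of two points at
  distance at most \<open>mesh k\<close> are within \<open>3 * mesh k\<close>, and consecutive grid
  points of one point are even closer.\<close>

definition links :: "nat \<Rightarrow> ('a \<times> 'a) set" where
  "links k = {(u, v) \<in> (net k \<union> net (Suc k)) \<times> (net k \<union> net (Suc k)). dist u v \<le> 3 * mesh k}"

text \<open>The mesh shrinks like \<open>(1/2) ^ k\<close>; any slower geometric rate for the admissible increments
  keeps their sum finite while their ratio to the mesh grows geometrically, so that the exceptional
  probabilities beat the number of links.\<close>

definition tame :: "nat \<Rightarrow> ('a \<Rightarrow> real) \<Rightarrow> bool" where
  "tame m f \<longleftrightarrow> (\<forall>k\<ge>m. \<forall>(u, v)\<in>links k. \<bar>f u - f v\<bar> \<le> (3/4) ^ k)"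

text \<open>A common modulus of continuity. The constant is 4 + 1 + 4: a chain from each of the two
  points to its grid point costs a geometric series of sum \<open>4 * (3/4) ^ k\<close>, and the
  link between the grid points costs \<open>(3/4) ^ k\<close>.\<close>

definition equi :: "nat \<Rightarrow> ('a \<Rightarrow> real) \<Rightarrow> bool" where
  "equi m f \<longleftrightarrow> (\<forall>k\<ge>m. \<forall>x\<in>D. \<forall>y\<in>D. dist x y \<le> mesh k \<longrightarrow> \<bar>f x - f y\<bar> \<le> 9 * (3/4) ^ k)"

text \<open>For arguments in \<open>D\<close> only values on \<open>skel\<close> enter, which is
  what allows a field known on \<open>skel\<close> to be extended to \<open>D\<close>.\<close>

definition lim_proj :: "('a \<Rightarrow> real) \<Rightarrow> 'a \<Rightarrow> real" where
  "lim_proj f x = lim (\<lambda>k. f (proj k x))"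

lemma finite_links: "finite (links k)"
  unfolding links_def by (rule finite_subset[of _ "(net k \<union> net (Suc k)) \<times> (net k \<union> net (Suc k))"])
    (auto simp: finite_net)

lemma links_subset: "(u, v) \<in> links k \<Longrightarrow> u \<in> skel \<and> v \<in> skel"
  by (auto simp: links_def net_in_skel)

lemma tame_step:
  assumes "tame m f" "m \<le> k" "x \<in> D"
  shows "\<bar>f (proj (Suc k) x) - f (proj k x)\<bar> \<le> (3/4) ^ k"
proof -
  have "dist (proj (Suc k) x) (proj k x) \<le> dist (proj (Suc k) x) x + dist (proj k x) x"
    by (rule dist_triangle2)
  also have "\<dots> \<le> 3 * mesh k"
    using dist_proj_le[OF assms(3), of k] dist_proj_le[OF assms(3), of "Suc k"] mesh_pos[of k]
    unfolding mesh_Suc by linarith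
  finally have "(proj (Suc k) x, proj k x) \<in> links k"
    by (auto simp: links_def proj_in_net assms)
  then show ?thesis using assms unfolding tame_def by blast
qed

text \<open>The subtracted term makes the induction exact, because
  \<open>4 * (3/4) ^ n - 4 * (3/4) ^ Suc n = (3/4) ^ n\<close>.\<close>

lemma tame_chain:
  assumes "tame m f" "m \<le> k" "x \<in> D"
  shows "\<bar>f (proj (k + j) x) - f (proj k x)\<bar> \<le> 4 * (3/4) ^ k - 4 * (3/4) ^ (k + j)"
proof (induction j)
  case (Suc j)
  have "\<bar>f (proj (Suc (k + j)) x) - f (proj (k + j) x)\<bar> \<le> (3/4) ^ (k + j)"
    by (rule tame_step[OF assms(1) _ assms(3)]) (use assms in auto)
  then show ?case using Suc by simp
qed simp

lemma ex_power_less: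
  fixes e :: real
  assumes "0 < e"
  shows "\<exists>k\<ge>m. 9 * (3/4) ^ k < e"
proof -
  have "(\<lambda>k. 9 * (3/4::real) ^ k) \<longlonglongrightarrow> 9 * 0" by (intro tendsto_intros) auto
  then have "\<forall>\<^sub>F k in sequentially. 9 * (3/4::real) ^ k < e"
    by (rule order_tendstoD(2)) (use assms in auto)
  then show ?thesis
    unfolding eventually_sequentially by (metis max.cobounded1 max.cobounded2)
qed

lemma tame_Cauchy:
  assumes "tame m f" "x \<in> D"
  shows "Cauchy (\<lambda>k. f (proj k x))"
proof (rule metric_CauchyI)
  fix e :: real assume "0 < e"
  \<comment> \<open>Two chains of total length \<open>4 * (3/4) ^ k\<close> each would require only
    the factor 8; the factor 9 is shared with \<open>equi\<close>.\<close>
  then obtain k where k: "k \<ge> m" "9 * (3/4::real) ^ k < e" using ex_power_less by blast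
  have "\<bar>f (proj i x) - f (proj k x)\<bar> < e / 2" if "i \<ge> k" for i
  proof -
    have "0 \<le> (3/4::real) ^ i" "0 \<le> (3/4::real) ^ k" by simp_all
    then show ?thesis
      using tame_chain[OF assms(1) k(1) assms(2), of "i - k"] k(2)
      unfolding le_add_diff_inverse[OF that] by linarith
  qed
  then show "\<exists>M. \<forall>i\<ge>M. \<forall>n\<ge>M. dist (f (proj i x)) (f (proj n x)) < e"
    unfolding dist_real_def by (intro exI[of _ k]) (smt (verit) field_sum_of_halves)
qed

lemma tame_tendsto:
  assumes "tame m f" "x \<in> D"
  shows "(\<lambda>k. f (proj k x)) \<longlonglongrightarrow> lim_proj f x"
  using real_Cauchy_convergent[OF tame_Cauchy[OF assms]]
  by (simp add: lim_proj_def convergent_LIMSEQ_iff)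

lemma tame_lim_proj_le:
  assumes "tame m f" "m \<le> k" "x \<in> D"
  shows "\<bar>lim_proj f x - f (proj k x)\<bar> \<le> 4 * (3/4) ^ k"
proof (rule LIMSEQ_le_const2)
  show "(\<lambda>i. \<bar>f (proj i x) - f (proj k x)\<bar>) \<longlonglongrightarrow> \<bar>lim_proj f x - f (proj k x)\<bar>"
    by (intro tendsto_intros tame_tendsto[OF assms(1,3)])
  show "\<exists>N. \<forall>i\<ge>N. \<bar>f (proj i x) - f (proj k x)\<bar> \<le> 4 * (3/4) ^ k"
  proof (intro exI allI impI)
    fix i assume "i \<ge> k"
    moreover have "0 \<le> (3/4::real) ^ i" by simp
    ultimately show "\<bar>f (proj i x) - f (proj k x)\<bar> \<le> 4 * (3/4) ^ k"
      using tame_chain[OF assms, of "i - k"] unfolding le_add_diff_inverse[OF \<open>i \<ge> k\<close>] by linarith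
  qed
qed

text \<open>The path from \<open>x\<close> to \<open>y\<close> runs down to \<open>proj k x\<close>,
  across one link to \<open>proj k y\<close>, and up again. Nothing is asked of \<open>f\<close>
  away from the grids, so the limit is continuous even when \<open>f\<close> is not.\<close>

lemma equi_lim_proj:
  assumes "tame m f"
  shows "equi m (lim_proj f)"
  unfolding equi_def
proof (intro allI impI ballI)
  fix k x y assume k: "m \<le> k" and xy: "x \<in> D" "y \<in> D" and d: "dist x y \<le> mesh k"
  have "dist (proj k x) (proj k y) \<le> dist (proj k x) x + dist x y + dist (proj k y) y"
    by (smt (verit) dist_commute dist_triangle)
  also have "\<dots> \<le> 3 * mesh k"
    using dist_proj_le[OF xy(1), of k] dist_proj_le[OF xy(2), of k] d by linarith
  finally have "(proj k x, proj k y) \<in> links k"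
    by (auto simp: links_def proj_in_net xy)
  then have "\<bar>f (proj k x) - f (proj k y)\<bar> \<le> (3/4) ^ k"
    using assms k unfolding tame_def by blast
  then show "\<bar>lim_proj f x - lim_proj f y\<bar> \<le> 9 * (3/4) ^ k"
    using tame_lim_proj_le[OF assms k xy(1)] tame_lim_proj_le[OF assms k xy(2)] by linarith
qed

lemma lim_proj_continuous:
  assumes "continuous_on D f" "x \<in> D"
  shows "lim_proj f x = f x"
  using continuous_proj_tendsto[OF assms] by (simp add: lim_proj_def limI)

lemma equi_cong: "(\<And>x. x \<in> D \<Longrightarrow> f x = g x) \<Longrightarrow> equi m f = equi m g"
  by (auto simp: equi_def)

lemma equi_if_tame: "tame m f \<Longrightarrow> continuous_on D f \<Longrightarrow> equi m f"
  using equi_lim_proj equi_cong[of "lim_proj f" f] lim_proj_continuous by blast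

lemma continuous_on_equi:
  assumes "equi m f"
  shows "continuous_on D f"
  unfolding continuous_on_iff
proof (intro ballI allI impI)
  fix x e assume x: "x \<in> D" and e: "0 < (e::real)"
  obtain k where k: "k \<ge> m" "9 * (3/4::real) ^ k < e" using ex_power_less[OF e] by blast
  show "\<exists>d>0. \<forall>x'\<in>D. dist x' x < d \<longrightarrow> dist (f x') (f x) < e"
    using assms k x mesh_pos[of k] unfolding equi_def dist_real_def
    by (intro exI[of _ "mesh k"]) fastforce
qed

section \<open>The uniform metric\<close>

lemma CD_bdd_above:
  assumes "f \<in> CD D" "g \<in> CD D"
  shows "bdd_above ((\<lambda>x. \<bar>f x - g x\<bar>) ` D)"
  using assms unfolding CD_def
  by (intro bounded_imp_bdd_above compact_imp_bounded compact_continuous_image continuous_intros compact_D) auto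

lemma le_sup_dist:
  assumes "f \<in> CD D" "g \<in> CD D" "x \<in> D"
  shows "\<bar>f x - g x\<bar> \<le> sup_dist D f g"
  unfolding sup_dist_def by (rule cSUP_upper[OF assms(3) CD_bdd_above[OF assms(1,2)]])

lemma sup_dist_le: "(\<And>x. x \<in> D \<Longrightarrow> \<bar>f x - g x\<bar> \<le> e) \<Longrightarrow> sup_dist D f g \<le> e"
  unfolding sup_dist_def by (rule cSUP_least[OF D_nonempty])

lemma space_borel_CD: "space (borel_CD D) = CD D"
  unfolding borel_CD_def by (rule space_measure_of) (auto simp: sup_open_def)

lemma borel_measurable_borel_CD:
  assumes "\<And>f e. f \<in> CD D \<Longrightarrow> 0 < e \<Longrightarrow> \<exists>\<delta>>0. \<forall>g\<in>CD D. sup_dist D f g < \<delta> \<longrightarrow> \<bar>F g - F f\<bar> < (e::real)"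
  shows "F \<in> borel_measurable (borel_CD D)"
proof (rule borel_measurableI)
  fix S :: "real set" assume S: "open S"
  have "sup_open D (F -` S \<inter> CD D)"
    unfolding sup_open_def
  proof (intro conjI ballI)
    fix f assume f: "f \<in> F -` S \<inter> CD D"
    then obtain e where e: "0 < e" "\<And>y. dist y (F f) < e \<Longrightarrow> y \<in> S"
      using S by (auto simp: open_dist)
    obtain \<delta> where "\<delta> > 0" "\<And>g. g \<in> CD D \<Longrightarrow> sup_dist D f g < \<delta> \<Longrightarrow> \<bar>F g - F f\<bar> < e"
      using assms f e(1) by blast
    then show "\<exists>e>0. \<forall>g\<in>CD D. sup_dist D f g < e \<longrightarrow> g \<in> F -` S \<inter> CD D"
      using e(2) by (auto simp: dist_real_def)
  qed auto
  then have "F -` S \<inter> CD D \<in> sets (borel_CD D)"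
    unfolding borel_CD_def by (subst sets_measure_of) (auto simp: sup_open_def)
  then show "F -` S \<inter> space (borel_CD D) \<in> sets (borel_CD D)"
    by (simp add: space_borel_CD)
qed

lemma measurable_eval_borel_CD:
  assumes "x \<in> D"
  shows "(\<lambda>f. f x) \<in> borel_measurable (borel_CD D)"
proof (rule borel_measurable_borel_CD)
  fix f e assume f: "f \<in> CD D" and "0 < (e::real)"
  then show "\<exists>\<delta>>0. \<forall>g\<in>CD D. sup_dist D f g < \<delta> \<longrightarrow> \<bar>g x - f x\<bar> < e"
    using le_sup_dist[OF f _ assms] by (intro exI[of _ e]) (force simp: abs_minus_commute)
qed

lemma measurable_bounded_cont_CD: "bounded_cont_CD D F \<Longrightarrow> F \<in> borel_measurable (borel_CD D)"
  by (rule borel_measurable_borel_CD) (auto simp: bounded_cont_CD_def)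

lemma sup_dist_le_skel:
  assumes "f \<in> CD D" "g \<in> CD D" "\<And>x. x \<in> skel \<Longrightarrow> \<bar>f x - g x\<bar> \<le> e"
  shows "sup_dist D f g \<le> e"
proof (rule sup_dist_le)
  fix x assume x: "x \<in> D"
  show "\<bar>f x - g x\<bar> \<le> e"
  proof (rule LIMSEQ_le_const2)
    show "(\<lambda>k. \<bar>f (proj k x) - g (proj k x)\<bar>) \<longlonglongrightarrow> \<bar>f x - g x\<bar>"
      using assms x by (intro tendsto_intros continuous_proj_tendsto) (auto simp: CD_def)
  qed (use assms(3) proj_in_net[OF x] net_in_skel in blast)
qed

text \<open>Separability in disguise: every open set is a countable union of sets given by
  countably many evaluations.\<close>

lemma measurable_borel_CDI:
  assumes X: "\<And>\<omega>. \<omega> \<in> space M \<Longrightarrow> X \<omega> \<in> CD D"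
    and meas: "\<And>x. x \<in> D \<Longrightarrow> (\<lambda>\<omega>. X \<omega> x) \<in> borel_measurable M"
  shows "X \<in> M \<rightarrow>\<^sub>M borel_CD D"
  unfolding borel_CD_def
proof (rule measurable_measure_of)
  show "{U. sup_open D U} \<subseteq> Pow (CD D)" by (auto simp: sup_open_def)
  show "X \<in> space M \<rightarrow> CD D" using X by auto
next
  fix U assume "U \<in> {U. sup_open D U}"
  then have U: "U \<subseteq> CD D" "\<And>f. f \<in> U \<Longrightarrow> \<exists>e>0. \<forall>g\<in>CD D. sup_dist D f g < e \<longrightarrow> g \<in> U"
    by (auto simp: sup_open_def)
  \<comment> \<open>A box prescribes finitely many values, each valid up to \<open>e\<close> at all
    points of \<open>skel\<close> near its base point. Rational parameters and base points in
    \<open>skel\<close> leave countably many boxes, and membership involves only countably many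
    evaluations.\<close>
  define box where "box = (\<lambda>(l, r, e). {f \<in> CD D. \<forall>p\<in>set l. \<forall>x\<in>skel. dist x (fst p) < r \<longrightarrow>
      \<bar>f x - snd p\<bar> \<le> (e::real)})"
  define I where "I = {t \<in> lists (skel \<times> \<rat>) \<times> \<rat> \<times> \<rat>. box t \<subseteq> U}"
  have countable_I: "countable I"
    unfolding I_def by (rule countable_subset[of _ "lists (skel \<times> \<rat>) \<times> \<rat> \<times> \<rat>"])
      (auto intro!: countable_SIGMA countable_lists countable_skel countable_rat)
  have "U \<subseteq> (\<Union>t\<in>I. box t)"
  proof
    fix f assume f: "f \<in> U"
    then have fC: "f \<in> CD D" using U by auto
    obtain d where d: "0 < d" "\<And>g. g \<in> CD D \<Longrightarrow> sup_dist D f g < d \<Longrightarrow> g \<in> U" using U(2)[OF f] by blast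
    \<comment> \<open>Two functions in the same box differ by at most \<open>2 * e\<close> once its
      base points form a net finer than \<open>r\<close>, hence the bound \<open>d / 2\<close>.
      Within \<open>e\<close>, one half is spent on the oscillation of \<open>f\<close> and the
      other on rounding its values to rationals.\<close>
    obtain e where e: "e \<in> \<rat>" "0 < e" "e < d / 2" using Rats_dense_in_real[of 0 "d / 2"] d(1) by auto
    have "uniformly_continuous_on D f"
      using compact_uniformly_continuous compact_D fC by (auto simp: CD_def)
    then obtain r0 where r0: "0 < r0" "\<And>x y. x \<in> D \<Longrightarrow> y \<in> D \<Longrightarrow> dist x y < r0 \<Longrightarrow> \<bar>f x - f y\<bar> < e / 2"
      unfolding uniformly_continuous_on_def dist_real_def using e by (metis half_gt_zero)
    obtain r where r: "r \<in> \<rat>" "0 < r" "r < r0" using Rats_dense_in_real[of 0 r0] r0(1) by auto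
    obtain k where k: "mesh k < r" using ex_mesh_less[OF r(2)] by blast
    have "\<exists>q\<in>\<rat>. \<bar>f u - q\<bar> < e / 2" for u
    proof -
      have "f u < f u + e / 2" using e(2) by simp
      then obtain q where "q \<in> \<rat>" "f u < q" "q < f u + e / 2" using Rats_dense_in_real by blast
      then show ?thesis by (intro bexI[of _ q]) auto
    qed
    then obtain q where q: "\<And>u. q u \<in> \<rat>" "\<And>u. \<bar>f u - q u\<bar> < e / 2" by metis
    obtain us where us: "set us = net k" using finite_list[OF finite_net] by blast
    define l where "l = map (\<lambda>u. (u, q u)) us"
    have fl: "\<bar>f x - q u\<bar> \<le> e" if "u \<in> net k" "x \<in> skel" "dist x u < r" for u x
    proof -
      have "\<bar>f x - f u\<bar> < e / 2"
        using that r(3) net_subset skel_subset by (intro r0(2)) auto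
      then show ?thesis using q(2)[of u] by linarith
    qed
    have "f \<in> box (l, r, e)"
      using fC fl by (auto simp: box_def l_def us)
    moreover have "box (l, r, e) \<subseteq> U"
    proof
      fix g assume g: "g \<in> box (l, r, e)"
      then have gC: "g \<in> CD D" by (auto simp: box_def)
      have "\<bar>f x - g x\<bar> \<le> 2 * e" if x: "x \<in> skel" for x
      proof -
        have xD: "x \<in> D" using x skel_subset by auto
        have dx: "dist x (proj k x) < r" using dist_proj_le[OF xD, of k] k by (simp add: dist_commute)
        have "\<bar>g x - q (proj k x)\<bar> \<le> e"
          using g x dx proj_in_net[OF xD, of k] by (auto simp: box_def l_def us)
        then show ?thesis using fl[OF proj_in_net[OF xD] x dx] by linarith
      qed
      then have "sup_dist D f g \<le> 2 * e" by (rule sup_dist_le_skel[OF fC gC])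
      then show "g \<in> U" using d(2)[OF gC] e(3) by auto
    qed
    moreover have "(l, r, e) \<in> lists (skel \<times> \<rat>) \<times> \<rat> \<times> \<rat>"
      using r(1) e(1) q(1) net_in_skel by (auto simp: l_def us)
    ultimately show "f \<in> (\<Union>t\<in>I. box t)" unfolding I_def by blast
  qed
  then have "U = (\<Union>t\<in>I. box t)" by (auto simp: I_def)
  then have eq: "X -` U \<inter> space M = (\<Union>t\<in>I. X -` box t \<inter> space M)" by auto
  have "X -` box t \<inter> space M \<in> sets M" for t
  proof (cases t)
    case (fields l r e)
    have [measurable (raw)]: "(\<lambda>\<omega>. X \<omega> x) \<in> borel_measurable M" if "x \<in> skel" for x
      using meas skel_subset that by auto
    have "X -` box t \<inter> space M =
      {\<omega> \<in> space M. \<forall>p\<in>set l. \<forall>x\<in>skel. dist x (fst p) < r \<longrightarrow> \<bar>X \<omega> x - snd p\<bar> \<le> e}"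
      using X by (auto simp: box_def fields)
    also have "\<dots> \<in> sets M"
    proof (intro sets.sets_Collect_countable_All' countable_skel countable_finite[OF finite_set])
      fix p :: "'a \<times> real" and x assume "x \<in> skel"
      then have "{\<omega> \<in> space M. \<bar>X \<omega> x - snd p\<bar> \<le> e} \<in> sets M" by measurable
      then show "{\<omega> \<in> space M. dist x (fst p) < r \<longrightarrow> \<bar>X \<omega> x - snd p\<bar> \<le> e} \<in> sets M"
        by (cases "dist x (fst p) < r") auto
    qed
    finally show ?thesis .
  qed
  then show "X -` U \<inter> space M \<in> sets M"
    unfolding eq by (intro sets.countable_UN' countable_I) blast
qed

section \<open>Compact sets of functions\<close>

definition CK :: "nat \<Rightarrow> real \<Rightarrow> ('a \<Rightarrow> real) set" where
  "CK m R = {f \<in> extensional D. (\<forall>u\<in>net m. \<bar>f u\<bar> \<le> R) \<and> equi m f}"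

lemma CK_subset_CD: "CK m R \<subseteq> CD D"
  by (auto simp: CK_def CD_def continuous_on_equi)

text \<open>Tychonoff for the box of pointwise bounds, intersected with closed conditions that
  involve at most two coordinates each. Off \<open>D\<close> the factor is the single point
  \<open>undefined\<close>, so the product over the whole type still has compact factors. On
  \<open>D\<close> the bound at the nearby point of \<open>net m\<close> spreads by
  equicontinuity.\<close>

lemma compact_CK: "compact (CK m R)"
proof -
  define B where "B = (\<lambda>x. if x \<in> D then {- (R + 9 * (3/4) ^ m) .. R + 9 * (3/4) ^ m} else {undefined :: real})"
  have "compactin (product_topology (\<lambda>_. euclidean) UNIV) (Pi\<^sub>E UNIV B)"
    unfolding compactin_PiE by (auto simp: B_def)
  then have "compact (Pi\<^sub>E UNIV B)" by (simp add: euclidean_product_topology)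
  moreover have "closed {f. (\<forall>u\<in>net m. \<bar>f u\<bar> \<le> R) \<and> equi m f}"
    proof -
    have "{f. (\<forall>u\<in>net m. \<bar>f u\<bar> \<le> R) \<and> equi m f} = (\<Inter>u\<in>net m. {f. \<bar>f u\<bar> \<le> R}) \<inter>
        (\<Inter>k\<in>{m..}. \<Inter>x\<in>D. \<Inter>y\<in>{y\<in>D. dist x y \<le> mesh k}. {f. \<bar>f x - f y\<bar> \<le> 9 * (3/4) ^ k})"
      by (auto simp: equi_def)
    moreover have "closed {f :: 'a \<Rightarrow> real. \<bar>f u\<bar> \<le> R}" for u
      by (intro closed_Collect_le continuous_on_rabs continuous_on_const continuous_on_product_coordinates)
    moreover have "closed {f :: 'a \<Rightarrow> real. \<bar>f x - f y\<bar> \<le> r}" for x y r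
      by (intro closed_Collect_le continuous_on_rabs continuous_on_diff continuous_on_const
          continuous_on_product_coordinates)
    ultimately show ?thesis by (simp add: closed_INT closed_Int)
  qed
  moreover have "CK m R = Pi\<^sub>E UNIV B \<inter> {f. (\<forall>u\<in>net m. \<bar>f u\<bar> \<le> R) \<and> equi m f}"
  proof (intro equalityI subsetI)
    fix f assume f: "f \<in> CK m R"
    have "\<bar>f x\<bar> \<le> R + 9 * (3/4) ^ m" if x: "x \<in> D" for x
    proof -
      have "\<bar>f (proj m x) - f x\<bar> \<le> 9 * (3/4) ^ m"
        using f x dist_proj_le[OF x, of m] proj_in_D[OF x, of m] by (auto simp: CK_def equi_def)
      moreover have "\<bar>f (proj m x)\<bar> \<le> R" using f proj_in_net[OF x, of m] by (auto simp: CK_def)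
      ultimately show ?thesis by linarith
    qed
    then have "f x \<in> B x" for x
      using f by (cases "x \<in> D") (force simp: B_def CK_def extensional_def abs_le_iff)+
    then show "f \<in> Pi\<^sub>E UNIV B \<inter> {f. (\<forall>u\<in>net m. \<bar>f u\<bar> \<le> R) \<and> equi m f}"
      using f by (auto simp: CK_def)
  next
    fix f assume f: "f \<in> Pi\<^sub>E UNIV B \<inter> {f. (\<forall>u\<in>net m. \<bar>f u\<bar> \<le> R) \<and> equi m f}"
    then have "f x = undefined" if "x \<notin> D" for x
      using that by (auto simp: B_def PiE_iff split: if_splits)
    then show "f \<in> CK m R" using f by (auto simp: CK_def extensional_def)
  qed
  ultimately show ?thesis by (simp add: compact_Int_closed)
qed

text \<open>On equicontinuous sets pointwise convergence is uniform.\<close>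

lemma continuous_on_CK:
  assumes "bounded_cont_CD D F"
  shows "continuous_on (CK m R) F"
  unfolding continuous_on_topological
proof (intro ballI allI impI)
  fix f B assume f: "f \<in> CK m R" and B: "open B" "F f \<in> B"
  then obtain e where e: "0 < e" "\<And>y. dist y (F f) < e \<Longrightarrow> y \<in> B" by (auto simp: open_dist)
  have fC: "f \<in> CD D" using f CK_subset_CD by blast
  obtain \<delta> where \<delta>: "\<delta> > 0" "\<And>g. g \<in> CD D \<Longrightarrow> sup_dist D f g < \<delta> \<Longrightarrow> \<bar>F g - F f\<bar> < e"
    using assms fC e(1) unfolding bounded_cont_CD_def by blast
  \<comment> \<open>Three quarters of \<open>\<delta>\<close> will be used: the oscillation of
    \<open>f\<close>, that of \<open>g\<close>, and their difference at a point of
    \<open>net k\<close>. Finiteness of \<open>net k\<close> makes the neighbourhood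
    \<open>W\<close> open in the product topology.\<close>
  obtain k where k: "k \<ge> m" "9 * (3/4::real) ^ k < \<delta> / 4" using ex_power_less[of "\<delta> / 4"] \<delta>(1) by auto
  define W where "W = {g. \<forall>u\<in>net k. \<bar>g u - f u\<bar> < \<delta> / 4}"
  have "W = (\<Inter>u\<in>net k. (\<lambda>g. g u) -` {y. \<bar>y - f u\<bar> < \<delta> / 4})" by (auto simp: W_def)
  then have "open W"
    by (auto intro!: open_INT open_coordinate_vimage open_Collect_less continuous_intros simp: finite_net)
  moreover have "f \<in> W" using \<delta>(1) by (auto simp: W_def)
  moreover have "F g \<in> B" if g: "g \<in> CK m R" "g \<in> W" for g
  proof -
    have "\<bar>f x - g x\<bar> \<le> 3 * \<delta> / 4" if x: "x \<in> D" for x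
    proof -
      have "\<bar>h (proj k x) - h x\<bar> \<le> 9 * (3/4) ^ k" if "h \<in> CK m R" for h
        using that x dist_proj_le[OF x, of k] proj_in_D[OF x, of k] k(1) by (auto simp: CK_def equi_def)
      from this[OF f] this[OF g(1)] k(2)
      have "\<bar>f (proj k x) - f x\<bar> \<le> \<delta> / 4" "\<bar>g (proj k x) - g x\<bar> \<le> \<delta> / 4" by linarith+
      moreover have "\<bar>g (proj k x) - f (proj k x)\<bar> < \<delta> / 4"
        using g(2) proj_in_net[OF x, of k] by (auto simp: W_def)
      ultimately show ?thesis by linarith
    qed
    then have "sup_dist D f g \<le> 3 * \<delta> / 4" by (rule sup_dist_le)
    then have "\<bar>F g - F f\<bar> < e" using g(1) CK_subset_CD \<delta> by (intro \<delta>(2)) auto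
    then show ?thesis using e(2) by (simp add: dist_real_def)
  qed
  ultimately show "\<exists>A. open A \<and> f \<in> A \<and> (\<forall>y\<in>CK m R. y \<in> A \<longrightarrow> F y \<in> B)" by blast
qed

end

section \<open>Tail bounds for chaining\<close>

lemma summable_double_exponential:
  fixes A B h q :: real
  assumes "0 \<le> A" "0 < B" "0 < h" "1 < q"
  shows "summable (\<lambda>k. A * B ^ k * exp (- h * q ^ k))"
proof -
  have "filterlim (\<lambda>k. q ^ k) at_top sequentially"
    using filterlim_at_infinity_imp_norm_at_top[OF filterlim_realpow_sequentially_gt1[of q]] assms(4)
    by (simp add: abs_of_pos)
  \<comment> \<open>Consecutive terms have the ratio
    \<open>B * exp (- (h * (q - 1) * q ^ k))\<close>; the threshold is where this drops to
    1/2.\<close>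
  then have "\<forall>\<^sub>F k in sequentially. ln (2 * B) / (h * (q - 1)) \<le> q ^ k"
    by (simp add: filterlim_at_top)
  then obtain N where N: "\<And>k. k \<ge> N \<Longrightarrow> ln (2 * B) / (h * (q - 1)) \<le> q ^ k"
    by (auto simp: eventually_sequentially)
  show ?thesis
  proof (rule summable_ratio_test[of "1/2" N])
    fix k assume "N \<le> k"
    then have "ln (2 * B) \<le> h * (q - 1) * q ^ k"
      using N[of k] assms by (simp add: pos_divide_le_eq mult_ac)
    then have "2 * B \<le> exp (h * (q - 1) * q ^ k)"
      using assms by (simp add: ln_ge_iff flip: ln_le_cancel_iff)
    then have "B * exp (- (h * (q - 1) * q ^ k)) \<le> 1 / 2"
      unfolding exp_minus by (simp add: pos_divide_le_eq del: exp_diff flip: divide_inverse)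
    then have "A * B ^ k * exp (- h * q ^ k) * (B * exp (- (h * (q - 1) * q ^ k))) \<le> A * B ^ k * exp (- h * q ^ k) * (1 / 2)"
      using assms by (intro mult_left_mono) auto
    moreover have "exp (- h * q ^ Suc k) = exp (- h * q ^ k) * exp (- (h * (q - 1) * q ^ k))"
      by (simp add: algebra_simps flip: exp_add)
    ultimately show "norm (A * B ^ Suc k * exp (- h * q ^ Suc k)) \<le> 1 / 2 * norm (A * B ^ k * exp (- h * q ^ k))"
      using assms by (simp add: abs_mult mult_ac)
  qed simp
qed

context compact_index begin

text \<open>The union bound over one level: a link has length at most \<open>3 * mesh k\<close> and
  is exceptional when its increment reaches \<open>(3/4) ^ k\<close>.\<close>

definition link_bound :: "real \<Rightarrow> nat \<Rightarrow> real" where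
  "link_bound c k = card (links k) * (2 * exp (- ((3/4) ^ k)\<^sup>2 / (2 * (c * (3 * mesh k))\<^sup>2)))"

definition tail_bound :: "real \<Rightarrow> nat \<Rightarrow> real" where
  "tail_bound c m = (\<Sum>k. link_bound c (k + m))"

lemma link_bound_nonneg: "0 \<le> link_bound c k"
  by (simp add: link_bound_def)

lemma summable_link_bound:
  assumes "0 < c"
  shows "summable (link_bound c)"
proof -
  define d where "d = real DIM('a)"
  obtain C where C: "0 < C" "\<And>k. real (card (net k)) \<le> C * (2 ^ DIM('a)) ^ k"
    using card_net_le by blast
  define B :: real where "B = 2 ^ DIM('a)"
  have B: "1 \<le> B" by (simp add: B_def)
  \<comment> \<open>Counting all pairs of points of the two nets is crude, but any purely
    exponential growth in \<open>k\<close> is harmless here.\<close>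
  have card: "real (card (links k)) \<le> (2 * C * B)\<^sup>2 * (B\<^sup>2) ^ k" for k
  proof -
    have "card (links k) \<le> card ((net k \<union> net (Suc k)) \<times> (net k \<union> net (Suc k)))"
      by (rule card_mono) (auto simp: links_def finite_net)
    also have "\<dots> = (card (net k \<union> net (Suc k)))\<^sup>2" by (simp add: card_cartesian_product power2_eq_square)
    also have "\<dots> \<le> (card (net k) + card (net (Suc k)))\<^sup>2" by (intro power_mono card_Un_le) simp
    finally have "real (card (links k)) \<le> (real (card (net k)) + real (card (net (Suc k))))\<^sup>2"
      by (metis of_nat_add of_nat_mono of_nat_power)
    also have "\<dots> \<le> (2 * C * B * B ^ k)\<^sup>2"
    proof (rule power_mono)
      have "C * B ^ k \<le> C * B ^ Suc k" using C(1) B by (intro mult_left_mono power_increasing) auto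
      then show "real (card (net k)) + real (card (net (Suc k))) \<le> 2 * C * B * B ^ k"
        using C(2)[of k] C(2)[of "Suc k"] by (simp add: B_def mult_ac)
    qed simp
    finally show ?thesis by (simp add: power_mult_distrib power2_eq_square mult_ac)
  qed
  define h where "h = 1 / (2 * (3 * c * d)\<^sup>2)"
  have d: "0 < d" by (simp add: d_def)
  have h: "0 < h" using assms d by (simp add: h_def)
  \<comment> \<open>Up to a constant, admissible increment over mesh is
    \<open>(3/4) ^ k * 2 ^ k = (3/2) ^ k\<close>; squaring gives the base \<open>9/4\<close>, which
    exceeds 1.\<close>
  have ex: "- ((3/4) ^ k)\<^sup>2 / (2 * (c * (3 * mesh k))\<^sup>2) = - h * (9/4) ^ k" for k
  proof -
    have "(9/4::real) ^ k = ((3/4) ^ k)\<^sup>2 * (2 ^ k)\<^sup>2"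
      by (simp add: power2_eq_square flip: power_mult_distrib)
    moreover have "- a\<^sup>2 / (2 * (c * (3 * (d / p)))\<^sup>2) = - h * (a\<^sup>2 * p\<^sup>2)" for a p :: real
      by (simp add: h_def power_mult_distrib power_divide)
    ultimately show ?thesis by (simp only: mesh_def d_def)
  qed
  show ?thesis
  proof (rule summable_comparison_test')
    show "summable (\<lambda>k. 2 * (2 * C * B)\<^sup>2 * (B\<^sup>2) ^ k * exp (- h * (9/4) ^ k))"
      using h C(1) B by (intro summable_double_exponential) auto
    fix k
    have "link_bound c k \<le> (2 * C * B)\<^sup>2 * (B\<^sup>2) ^ k * (2 * exp (- h * (9/4) ^ k))"
      unfolding link_bound_def ex by (intro mult_right_mono card) auto
    then show "norm (link_bound c k) \<le> 2 * (2 * C * B)\<^sup>2 * (B\<^sup>2) ^ k * exp (- h * (9/4) ^ k)"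
      using link_bound_nonneg[of c k] by (simp add: mult_ac)
  qed
qed

lemma tail_bound_tendsto_0: "0 < c \<Longrightarrow> tail_bound c \<longlonglongrightarrow> 0"
  unfolding tail_bound_def[abs_def] by (intro suminf_exist_split2 summable_link_bound)

text \<open>Stated with an upper bound \<open>a\<close> for the distance, so that
  \<open>a = 3 * mesh k\<close> serves all links of a level at once, and only on
  \<open>skel\<close>, where the Gaussian family is first constructed.\<close>

definition subgaussian_increments :: "'w measure \<Rightarrow> ('w \<Rightarrow> 'a \<Rightarrow> real) \<Rightarrow> real \<Rightarrow> bool" where
  "subgaussian_increments M X c \<longleftrightarrow> (\<forall>u\<in>skel. (\<lambda>\<omega>. X \<omega> u) \<in> borel_measurable M) \<and>
    (\<forall>u\<in>skel. \<forall>v\<in>skel. \<forall>a s. 0 < a \<longrightarrow> 0 < s \<longrightarrow> dist u v \<le> a \<longrightarrow>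
      measure M {\<omega>\<in>space M. s \<le> \<bar>X \<omega> u - X \<omega> v\<bar>} \<le> 2 * exp (- s\<^sup>2 / (2 * (c * a)\<^sup>2)))"

lemma subgaussian_incrementsD:
  assumes "subgaussian_increments M X c" "u \<in> skel" "v \<in> skel" "0 < a" "0 < s" "dist u v \<le> a"
  shows "measure M {\<omega>\<in>space M. s \<le> \<bar>X \<omega> u - X \<omega> v\<bar>} \<le> 2 * exp (- s\<^sup>2 / (2 * (c * a)\<^sup>2))"
  using assms unfolding subgaussian_increments_def by simp

lemma sets_tame:
  assumes meas: "\<And>u. u \<in> skel \<Longrightarrow> (\<lambda>\<omega>. X \<omega> u) \<in> borel_measurable M"
  shows "{\<omega>\<in>space M. tame m (X \<omega>)} \<in> sets M"
proof -
  have "{\<omega>\<in>space M. tame m (X \<omega>)} = {\<omega>\<in>space M. \<forall>k\<in>{m..}. \<forall>p\<in>links k. \<bar>X \<omega> (fst p) - X \<omega> (snd p)\<bar> \<le> (3/4) ^ k}"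
    by (auto simp: tame_def split_beta)
  also have "\<dots> \<in> sets M"
  proof (intro sets.sets_Collect_countable_All' countable_finite[OF finite_links])
    fix k p assume "p \<in> links k"
    then have [measurable]: "(\<lambda>\<omega>. X \<omega> (fst p)) \<in> borel_measurable M" "(\<lambda>\<omega>. X \<omega> (snd p)) \<in> borel_measurable M"
      using links_subset[of "fst p" "snd p" k] by (auto intro: meas)
    show "{\<omega>\<in>space M. \<bar>X \<omega> (fst p) - X \<omega> (snd p)\<bar> \<le> (3/4) ^ k} \<in> sets M" by measurable
  qed auto
  finally show ?thesis .
qed

lemma prob_not_tame_le:
  assumes "prob_space M" and sg: "subgaussian_increments M X c" and "0 < c"
  shows "measure M {\<omega>\<in>space M. \<not> tame m (X \<omega>)} \<le> tail_bound c m"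
proof -
  interpret prob_space M by fact
  have meas: "(\<lambda>\<omega>. X \<omega> u) \<in> borel_measurable M" if "u \<in> skel" for u
    using sg that by (auto simp: subgaussian_increments_def)
  define E where "E k p = {\<omega>\<in>space M. (3/4) ^ k \<le> \<bar>X \<omega> (fst p) - X \<omega> (snd p)\<bar>}" for k p
  have E: "E k p \<in> sets M" if "p \<in> links k" for k p
  proof -
    have [measurable]: "(\<lambda>\<omega>. X \<omega> (fst p)) \<in> borel_measurable M" "(\<lambda>\<omega>. X \<omega> (snd p)) \<in> borel_measurable M"
      using links_subset[of "fst p" "snd p" k] that by (auto intro: meas)
    show ?thesis unfolding E_def by measurable
  qed
  have UE: "(\<Union>p\<in>links k. E k p) \<in> sets M" for k
    using E by (intro sets.finite_UN finite_links) auto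
  have le: "measure M (\<Union>p\<in>links k. E k p) \<le> link_bound c k" for k
  proof -
    have "measure M (\<Union>p\<in>links k. E k p) \<le> (\<Sum>p\<in>links k. measure M (E k p))"
      using E by (intro finite_measure_subadditive_finite finite_links) auto
    also have "\<dots> \<le> (\<Sum>p\<in>links k. 2 * exp (- ((3/4) ^ k)\<^sup>2 / (2 * (c * (3 * mesh k))\<^sup>2)))"
    proof (rule sum_mono)
      fix p assume p: "p \<in> links k"
      then have "fst p \<in> skel" "snd p \<in> skel" "dist (fst p) (snd p) \<le> 3 * mesh k"
        using links_subset[of "fst p" "snd p" k] by (auto simp: links_def)
      moreover have "0 < (3/4 :: real) ^ k" "0 < 3 * mesh k" using mesh_pos by auto
      ultimately show "measure M (E k p) \<le> 2 * exp (- ((3/4) ^ k)\<^sup>2 / (2 * (c * (3 * mesh k))\<^sup>2))"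
        unfolding E_def by (intro subgaussian_incrementsD[OF sg])
    qed
    finally show ?thesis by (simp add: link_bound_def)
  qed
  have sum: "summable (\<lambda>k. link_bound c (k + m))"
    using summable_link_bound[OF \<open>0 < c\<close>] by (rule summable_ignore_initial_segment)
  have sum': "summable (\<lambda>k. measure M (\<Union>p\<in>links (k + m). E (k + m) p))"
    by (rule summable_comparison_test'[OF sum, of 0]) (use le in auto)
  have "measure M {\<omega>\<in>space M. \<not> tame m (X \<omega>)} \<le> measure M (\<Union>k. \<Union>p\<in>links (k + m). E (k + m) p)"
  proof (rule finite_measure_mono)
    show "(\<Union>k. \<Union>p\<in>links (k + m). E (k + m) p) \<in> sets M" using UE by auto
    show "{\<omega>\<in>space M. \<not> tame m (X \<omega>)} \<subseteq> (\<Union>k. \<Union>p\<in>links (k + m). E (k + m) p)"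
    proof
      fix \<omega> assume "\<omega> \<in> {\<omega>\<in>space M. \<not> tame m (X \<omega>)}"
      then obtain k p where *: "\<omega> \<in> space M" "m \<le> k" "p \<in> links k" "(3/4) ^ k < \<bar>X \<omega> (fst p) - X \<omega> (snd p)\<bar>"
        unfolding tame_def by fastforce
      then have "\<omega> \<in> E (k - m + m) p" "p \<in> links (k - m + m)" by (auto simp: E_def)
      then show "\<omega> \<in> (\<Union>k. \<Union>p\<in>links (k + m). E (k + m) p)" by blast
    qed
  qed
  also have "\<dots> \<le> (\<Sum>k. measure M (\<Union>p\<in>links (k + m). E (k + m) p))"
    using UE by (intro finite_measure_subadditive_countably sum') auto
  also have "\<dots> \<le> tail_bound c m"
    unfolding tail_bound_def by (intro suminf_le le sum sum')
  finally show ?thesis .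
qed

lemma AE_ex_tame:
  assumes "prob_space M" and sg: "subgaussian_increments M X c" and "0 < c"
  shows "AE \<omega> in M. \<exists>m. tame m (X \<omega>)"
proof -
  interpret prob_space M by fact
  define G where "G = (\<Inter>m. {\<omega>\<in>space M. \<not> tame m (X \<omega>)})"
  have N: "{\<omega>\<in>space M. \<not> tame m (X \<omega>)} \<in> sets M" for m
    using sg by (intro sets.sets_Collect_neg sets_tame) (auto simp: subgaussian_increments_def)
  have G: "G \<in> sets M" unfolding G_def using N by (intro sets.countable_INT) auto
  have "measure M G \<le> tail_bound c m" for m
  proof -
    have "measure M G \<le> measure M {\<omega>\<in>space M. \<not> tame m (X \<omega>)}"
      by (rule finite_measure_mono[OF _ N]) (auto simp: G_def)
    also have "\<dots> \<le> tail_bound c m" by (rule prob_not_tame_le[OF assms])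
    finally show ?thesis .
  qed
  then have "measure M G \<le> 0" using LIMSEQ_le_const[OF tail_bound_tendsto_0[OF \<open>0 < c\<close>]] by blast
  then have "G \<in> null_sets M" using G by (auto simp: null_sets_def emeasure_eq_measure measure_le_0_iff)
  then show ?thesis by (rule AE_I') (auto simp: G_def)
qed

definition escape_bound :: "real \<Rightarrow> real \<Rightarrow> nat \<Rightarrow> real \<Rightarrow> real" where
  "escape_bound c b m R = tail_bound c m + card (net m) * (2 * exp (- R\<^sup>2 / (2 * b\<^sup>2)))"

text \<open>The order of choice matters: the level \<open>m\<close> settles the modulus of
  continuity, and only then is \<open>R\<close> taken large enough to beat the number of points of
  \<open>net m\<close>.\<close>

lemma ex_escape_bound_less:
  assumes "0 < c" "0 < b" "0 < e"
  shows "\<exists>m. \<exists>R>0. escape_bound c b m R < e"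
proof -
  have "\<forall>\<^sub>F m in sequentially. tail_bound c m < e / 2"
    using tail_bound_tendsto_0[OF assms(1)] assms(3) by (intro order_tendstoD(2)) auto
  then obtain m where m: "tail_bound c m < e / 2" by (auto simp: eventually_sequentially)
  have "filterlim (\<lambda>R::real. R\<^sup>2) at_top at_top"
    by (intro filterlim_pow_at_top filterlim_ident) auto
  then have "filterlim (\<lambda>R::real. R\<^sup>2 / (2 * b\<^sup>2)) at_top at_top"
    unfolding divide_inverse mult.commute[of _ "inverse (2 * b\<^sup>2)"]
    by (rule filterlim_tendsto_pos_mult_at_top[OF tendsto_const, rotated]) (use assms(2) in simp)
  then have "((\<lambda>R. exp (- (R\<^sup>2 / (2 * b\<^sup>2)))) \<longlongrightarrow> 0) at_top"
    by (intro filterlim_compose[OF exp_at_bot] filterlim_uminus_at_top[THEN iffD1])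
  then have "((\<lambda>R. card (net m) * (2 * exp (- R\<^sup>2 / (2 * b\<^sup>2)))) \<longlongrightarrow> real (card (net m)) * (2 * 0)) at_top"
    by (intro tendsto_mult tendsto_const) (simp only: minus_divide_left)
  then have "\<forall>\<^sub>F R in at_top. card (net m) * (2 * exp (- R\<^sup>2 / (2 * b\<^sup>2))) < e / 2"
    by (rule order_tendstoD(2)) (use assms in auto)
  then have "\<forall>\<^sub>F R in at_top. card (net m) * (2 * exp (- R\<^sup>2 / (2 * b\<^sup>2))) < e / 2 \<and> 0 < R"
    using eventually_gt_at_top by (rule eventually_conj)
  from eventually_happens'[OF trivial_limit_at_top_linorder this]
  obtain R where "card (net m) * (2 * exp (- R\<^sup>2 / (2 * b\<^sup>2))) < e / 2" "0 < R" by blast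
  then show ?thesis using m by (intro exI[of _ m] exI[of _ R]) (simp add: escape_bound_def)
qed

definition subgaussian_values :: "'w measure \<Rightarrow> ('w \<Rightarrow> 'a \<Rightarrow> real) \<Rightarrow> real \<Rightarrow> bool" where
  "subgaussian_values M X b \<longleftrightarrow>
    (\<forall>u\<in>skel. \<forall>s>0. measure M {\<omega>\<in>space M. s \<le> \<bar>X \<omega> u\<bar>} \<le> 2 * exp (- s\<^sup>2 / (2 * b\<^sup>2)))"

text \<open>\<open>CK m R\<close> imposes uncountably many conditions, so a measurable event on
  which the path lies in it is exhibited instead. Continuity of the paths turns \<open>tame\<close>,
  which speaks of grid points only, into \<open>equi\<close> on all of \<open>D\<close>.\<close>

lemma prob_escape_le:
  assumes "prob_space M" and sg: "subgaussian_increments M X c" and sv: "subgaussian_values M X b"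
    and "0 < c" "0 < R" and XC: "\<And>\<omega>. \<omega> \<in> space M \<Longrightarrow> X \<omega> \<in> CD D"
  shows "\<exists>G\<in>sets M. measure M (space M - G) \<le> escape_bound c b m R \<and> (\<forall>\<omega>\<in>G. X \<omega> \<in> CK m R)"
proof -
  interpret prob_space M by fact
  have meas: "(\<lambda>\<omega>. X \<omega> u) \<in> borel_measurable M" if "u \<in> skel" for u
    using sg that by (auto simp: subgaussian_increments_def)
  define T where "T = {\<omega>\<in>space M. \<not> tame m (X \<omega>)}"
  define E where "E u = {\<omega>\<in>space M. R \<le> \<bar>X \<omega> u\<bar>}" for u
  have T: "T \<in> sets M" unfolding T_def by (intro sets.sets_Collect_neg sets_tame meas)
  have E: "E u \<in> sets M" if "u \<in> net m" for u
    using meas[OF net_in_skel[OF that]] unfolding E_def by measurable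
  have UE: "(\<Union>u\<in>net m. E u) \<in> sets M"
    using E by (intro sets.finite_UN finite_net) auto
  have "measure M (\<Union>u\<in>net m. E u) \<le> (\<Sum>u\<in>net m. measure M (E u))"
    using E by (intro finite_measure_subadditive_finite finite_net) auto
  also have "\<dots> \<le> (\<Sum>u\<in>net m. 2 * exp (- R\<^sup>2 / (2 * b\<^sup>2)))"
    using sv \<open>0 < R\<close> net_in_skel unfolding subgaussian_values_def E_def by (intro sum_mono) auto
  finally have "measure M (T \<union> (\<Union>u\<in>net m. E u)) \<le> escape_bound c b m R"
    using prob_not_tame_le[OF assms(1) sg \<open>0 < c\<close>, of m] measure_Un_le[OF T UE]
    by (simp add: escape_bound_def T_def)
  moreover have "space M - (space M - (T \<union> (\<Union>u\<in>net m. E u))) = T \<union> (\<Union>u\<in>net m. E u)"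
    by (auto simp: T_def E_def)
  moreover have "X \<omega> \<in> CK m R" if "\<omega> \<in> space M - (T \<union> (\<Union>u\<in>net m. E u))" for \<omega>
    using that XC[of \<omega>] equi_if_tame[of m "X \<omega>"] by (auto simp: CK_def CD_def T_def E_def)
  ultimately show ?thesis
    using T UE by (intro bexI[of _ "space M - (T \<union> (\<Union>u\<in>net m. E u))"]) auto
qed

end

section \<open>Centred Gaussian laws on the line\<close>

text \<open>As an image of the standard normal law under scaling, the degenerate case
  \<open>v = 0\<close> is treated together with the others from here on.\<close>

lemma gaussian_law_eq_distr:
  assumes "0 \<le> v"
  shows "gaussian_law 0 v = distr std_normal_distribution borel (\<lambda>x. sqrt v * x)"
proof (cases "v = 0")
  case True
  interpret real_distribution std_normal_distribution by (rule real_dist_normal_dist)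
  show ?thesis using True by (simp add: gaussian_law_def)
next
  case False
  interpret real_distribution std_normal_distribution by (rule real_dist_normal_dist)
  have "distributed std_normal_distribution lborel (\<lambda>x. x) (\<lambda>x. ennreal (normal_density 0 1 x))"
    unfolding distributed_def by (auto simp: distr_id2)
  from normal_density_affine[OF this, of "sqrt v" 0] False assms
  have "distributed std_normal_distribution lborel (\<lambda>x. sqrt v * x) (\<lambda>x. ennreal (normal_density 0 (sqrt v) x))"
    by simp
  then have "distr std_normal_distribution lborel (\<lambda>x. sqrt v * x) = density lborel (normal_density 0 (sqrt v))"
    by (simp add: distributed_def)
  moreover have "distr std_normal_distribution lborel (\<lambda>x. sqrt v * x) = distr std_normal_distribution borel (\<lambda>x. sqrt v * x)"
    by (rule distr_cong) auto
  ultimately show ?thesis using False by (simp add: gaussian_law_def)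
qed

lemma real_distribution_gaussian_law: "0 \<le> v \<Longrightarrow> real_distribution (gaussian_law 0 v)"
proof -
  assume "0 \<le> v"
  interpret real_distribution std_normal_distribution by (rule real_dist_normal_dist)
  show ?thesis unfolding gaussian_law_eq_distr[OF \<open>0 \<le> v\<close>] by (intro real_distribution_distr) simp
qed

lemma char_gaussian_law:
  assumes "0 \<le> v"
  shows "char (gaussian_law 0 v) t = of_real (exp (- (v * t\<^sup>2) / 2))"
proof -
  have "char (gaussian_law 0 v) t = char std_normal_distribution (t * sqrt v)"
    unfolding gaussian_law_eq_distr[OF assms] char_def
    by (subst integral_distr) (auto simp: mult_ac)
  then show ?thesis using assms
    by (simp add: char_std_normal_distribution power_mult_distrib mult_ac)
qed

lemma gaussian_law_moments:
  assumes "0 \<le> v"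
  shows "integrable (gaussian_law 0 v) (\<lambda>x. x)" "integral\<^sup>L (gaussian_law 0 v) (\<lambda>x. x) = 0"
    "integrable (gaussian_law 0 v) (\<lambda>x. x\<^sup>2)" "integral\<^sup>L (gaussian_law 0 v) (\<lambda>x. x\<^sup>2) = v"
proof -
  have 1: "integrable std_normal_distribution (\<lambda>x. x)" "integral\<^sup>L std_normal_distribution (\<lambda>x. x) = 0"
    using integrable_std_normal_distribution_moment[of 1] integral_std_normal_distribution_moment_odd[of 1]
    by simp_all
  have 2: "integrable std_normal_distribution (\<lambda>x. x\<^sup>2)" "integral\<^sup>L std_normal_distribution (\<lambda>x. x\<^sup>2) = 1"
    using std_normal_distribution_even_moments[of 1] by (simp_all add: fact_numeral)
  have m: "(\<lambda>x. sqrt v * x) \<in> borel_measurable std_normal_distribution" by simp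
  show "integrable (gaussian_law 0 v) (\<lambda>x. x)"
    unfolding gaussian_law_eq_distr[OF assms] by (subst integrable_distr_eq[OF m]) (simp_all add: 1)
  show "integral\<^sup>L (gaussian_law 0 v) (\<lambda>x. x) = 0"
    unfolding gaussian_law_eq_distr[OF assms] by (subst integral_distr[OF m]) (simp_all add: 1)
  show "integrable (gaussian_law 0 v) (\<lambda>x. x\<^sup>2)"
    unfolding gaussian_law_eq_distr[OF assms] using assms
    by (subst integrable_distr_eq[OF m]) (simp_all add: 2 power_mult_distrib)
  show "integral\<^sup>L (gaussian_law 0 v) (\<lambda>x. x\<^sup>2) = v"
    unfolding gaussian_law_eq_distr[OF assms] using assms
    by (subst integral_distr[OF m]) (simp_all add: 2 power_mult_distrib)
qed

text \<open>Both tails are dominated by exponentially tilted normal densities centred at \<open>s\<close> and \<open>- s\<close>.\<close>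

lemma gaussian_law_tail:
  assumes "0 \<le> v" "v \<le> a\<^sup>2" "0 < s"
  shows "measure (gaussian_law 0 v) {x. s \<le> \<bar>x\<bar>} \<le> 2 * exp (- s\<^sup>2 / (2 * a\<^sup>2))"
proof (cases "v = 0")
  case True
  then show ?thesis using assms by (simp add: gaussian_law_def measure_return indicator_def)
next
  case False
  define \<sigma> where "\<sigma> = sqrt v"
  have \<sigma>: "0 < \<sigma>" "\<sigma>\<^sup>2 = v" using False assms by (auto simp: \<sigma>_def)
  define E where "E = exp (- s\<^sup>2 / (2 * v))"
  have v: "0 < v" using False assms by simp
  have dens: "normal_density 0 \<sigma> x \<le> E * (normal_density s \<sigma> x + normal_density (- s) \<sigma> x)" if "s \<le> \<bar>x\<bar>" for x
  proof -
    \<comment> \<open>Completing the square. For \<open>m = s\<close> or \<open>m = - s\<close>,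
      whichever has the sign of \<open>x\<close>, the exponent is at most
      \<open>- s\<^sup>2 / (2 * v)\<close> on the tail.\<close>
    have tilt: "normal_density 0 \<sigma> x = exp ((m\<^sup>2 - 2 * m * x) / (2 * v)) * normal_density m \<sigma> x" for m
      using v unfolding normal_density_def \<sigma>(2)
      by (simp add: mult.left_commute power2_diff flip: exp_add) (simp add: field_simps)
    have "normal_density 0 \<sigma> x \<le> E * normal_density m \<sigma> x" if "m\<^sup>2 = s\<^sup>2" "s\<^sup>2 \<le> m * x" for m
    proof -
      have "(m\<^sup>2 - 2 * m * x) / (2 * v) \<le> (- s\<^sup>2) / (2 * v)"
        using that v by (intro divide_right_mono) auto
      then show ?thesis
        unfolding tilt[of m] E_def by (intro mult_right_mono normal_density_nonneg) (simp only: exp_le_cancel_iff)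
    qed
    from this[of s] this[of "- s"] show ?thesis
    proof (cases "0 \<le> x")
      case True
      then have "s\<^sup>2 \<le> s * x" using \<open>s \<le> \<bar>x\<bar>\<close> assms(3) by (simp add: power2_eq_square mult_left_mono)
      then have "normal_density 0 \<sigma> x \<le> E * normal_density s \<sigma> x"
        using \<open>\<And>m. m\<^sup>2 = s\<^sup>2 \<Longrightarrow> s\<^sup>2 \<le> m * x \<Longrightarrow> normal_density 0 \<sigma> x \<le> E * normal_density m \<sigma> x\<close> by blast
      then show ?thesis by (simp add: E_def distrib_left add_increasing2 normal_density_nonneg)
    next
      case False
      then have "s\<^sup>2 \<le> - s * x"
        using \<open>s \<le> \<bar>x\<bar>\<close> assms(3) mult_left_mono[of s "- x" s] by (simp add: power2_eq_square)
      then have "normal_density 0 \<sigma> x \<le> E * normal_density (- s) \<sigma> x"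
        using \<open>\<And>m. m\<^sup>2 = s\<^sup>2 \<Longrightarrow> s\<^sup>2 \<le> m * x \<Longrightarrow> normal_density 0 \<sigma> x \<le> E * normal_density m \<sigma> x\<close>[of "- s"] by simp
      then show ?thesis by (simp add: E_def distrib_left add_increasing normal_density_nonneg)
    qed
  qed
  interpret real_distribution "gaussian_law 0 v" by (rule real_distribution_gaussian_law) fact
  have "emeasure (gaussian_law 0 v) {x. s \<le> \<bar>x\<bar>} =
      (\<integral>\<^sup>+x. ennreal (normal_density 0 \<sigma> x) * indicator {x. s \<le> \<bar>x\<bar>} x \<partial>lborel)"
    using False by (simp add: gaussian_law_def emeasure_density flip: \<sigma>_def)
  also have "\<dots> \<le> (\<integral>\<^sup>+x. ennreal (E * (normal_density s \<sigma> x + normal_density (- s) \<sigma> x)) \<partial>lborel)"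
    by (intro nn_integral_mono) (auto simp: indicator_def dens ennreal_leI)
  also have "\<dots> = ennreal (\<integral>x. E * (normal_density s \<sigma> x + normal_density (- s) \<sigma> x) \<partial>lborel)"
    using \<sigma>(1) by (intro nn_integral_eq_integral integrable_mult_right Bochner_Integration.integrable_add
        integrable_normal_density AE_I2) (auto simp: E_def normal_density_nonneg)
  \<comment> \<open>Each tilted density has total mass 1, whence the factor 2.\<close>
  also have "(\<integral>x. E * (normal_density s \<sigma> x + normal_density (- s) \<sigma> x) \<partial>lborel) = 2 * E"
    using \<sigma>(1) by (simp add: integral_normal_density integrable_normal_density)
  finally have "measure (gaussian_law 0 v) {x. s \<le> \<bar>x\<bar>} \<le> 2 * E"
    by (simp add: emeasure_eq_measure E_def)
  also have "E \<le> exp (- s\<^sup>2 / (2 * a\<^sup>2))"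
    using assms v by (simp add: E_def frac_le)
  finally show ?thesis by simp
qed

section \<open>Gaussian sequences with a given covariance\<close>

text \<open>The points are indexed by \<open>nat\<close> and may repeat, so that the property passes
  along maps that are not injective, such as \<open>proj n\<close>.\<close>

definition pos_def_kernel_on :: "'b set \<Rightarrow> ('b \<Rightarrow> 'b \<Rightarrow> real) \<Rightarrow> bool" where
  "pos_def_kernel_on A K \<longleftrightarrow> (\<forall>x\<in>A. \<forall>y\<in>A. K x y = K y x) \<and>
    (\<forall>(I::nat set) c x. finite I \<longrightarrow> (\<forall>i\<in>I. x i \<in> A) \<longrightarrow> 0 \<le> (\<Sum>i\<in>I. \<Sum>j\<in>I. c i * c j * K (x i) (x j)))"

definition psd :: "(nat \<Rightarrow> nat \<Rightarrow> real) \<Rightarrow> bool" where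
  "psd K \<longleftrightarrow> (\<forall>i j. K i j = K j i) \<and> (\<forall>I c. finite I \<longrightarrow> 0 \<le> (\<Sum>i\<in>I. \<Sum>j\<in>I. c i * c j * K i j))"

lemma psd_sym: "psd K \<Longrightarrow> K i j = K j i"
  by (auto simp: psd_def)

text \<open>The quadratic form at \<open>c\<close> plus \<open>t\<close> times the
  \<open>m\<close>-th unit vector, whether or not \<open>m\<close> lies in \<open>I\<close>. As a
  polynomial in \<open>t\<close> it carries the Cauchy-Schwarz inequality in a form that survives a
  zero pivot.\<close>

lemma psd_shift:
  assumes "psd K" "finite I"
  shows "0 \<le> (\<Sum>i\<in>I. \<Sum>j\<in>I. c i * c j * K i j) + 2 * t * (\<Sum>i\<in>I. c i * K i m) + t\<^sup>2 * K m m"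
proof -
  define d where "d i = (if i \<in> I then c i else 0) + (if i = m then t else 0)" for i
  have d: "(\<Sum>i\<in>insert m I. d i * g i) = (\<Sum>i\<in>I. c i * g i) + t * g m" for g :: "nat \<Rightarrow> real"
  proof -
    have "(\<Sum>i\<in>insert m I. d i * g i) = (\<Sum>i\<in>insert m I. (if i \<in> I then c i * g i else 0)) +
        (\<Sum>i\<in>insert m I. if i = m then t * g m else 0)"
      unfolding d_def sum.distrib[symmetric] by (intro sum.cong) (auto simp: distrib_right)
    also have "(\<Sum>i\<in>insert m I. (if i \<in> I then c i * g i else 0)) = (\<Sum>i\<in>I. c i * g i)"
      using assms(2) by (intro sum.mono_neutral_cong_right) auto
    finally show ?thesis using assms(2) by simp
  qed
  have "0 \<le> (\<Sum>i\<in>insert m I. \<Sum>j\<in>insert m I. d i * d j * K i j)"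
    using assms unfolding psd_def by blast
  also have "\<dots> = (\<Sum>i\<in>insert m I. d i * (\<Sum>j\<in>insert m I. d j * K i j))"
    by (simp only: sum_distrib_left mult.assoc)
  also have "\<dots> = (\<Sum>i\<in>I. c i * ((\<Sum>j\<in>I. c j * K i j) + t * K i m)) + t * ((\<Sum>j\<in>I. c j * K m j) + t * K m m)"
    by (simp only: d)
  also have "(\<Sum>j\<in>I. c j * K m j) = (\<Sum>i\<in>I. c i * K i m)"
    using psd_sym[OF assms(1)] by simp
  finally show ?thesis
    by (simp add: sum.distrib distrib_left sum_distrib_left power2_eq_square mult_ac)
qed

lemma psd_diag_nonneg: "psd K \<Longrightarrow> 0 \<le> K m m"
  using psd_shift[of K "{}" _ 1 m] by simp

text \<open>With a vanishing diagonal entry the polynomial of \<open>psd_shift\<close> is affine in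
  \<open>t\<close>, and an affine function bounded below is constant.\<close>

lemma psd_diag_zero:
  assumes "psd K" "K m m = 0"
  shows "(\<Sum>i\<in>I. c i * K i m) = 0"
proof (cases "finite I")
  case True
  define b where "b = (\<Sum>i\<in>I. c i * K i m)"
  define a where "a = (\<Sum>i\<in>I. \<Sum>j\<in>I. c i * c j * K i j)"
  have "0 \<le> a + 2 * t * b" for t
    using psd_shift[OF assms(1) True, of c t m] assms(2) by (simp add: a_def b_def)
  \<comment> \<open>If \<open>b\<close> were not zero, this \<open>t\<close> would give the value
    \<open>- 1\<close>.\<close>
  from this[of "- (a + 1) / (2 * b)"] show ?thesis
    unfolding b_def[symmetric] by (cases "b = 0") (auto simp: field_simps)
qed simp

text \<open>If the pivot \<open>schur K m m m\<close> vanishes, so does its whole column, and \<open>x / 0 = 0\<close> makes the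
  step the identity; no pivoting is needed for degenerate kernels.\<close>

fun schur :: "(nat \<Rightarrow> nat \<Rightarrow> real) \<Rightarrow> nat \<Rightarrow> nat \<Rightarrow> nat \<Rightarrow> real" where
  "schur K 0 = K"
| "schur K (Suc m) = (\<lambda>i j. schur K m i j - schur K m i m * schur K m m j / schur K m m m)"

lemma psd_schur: "psd K \<Longrightarrow> psd (schur K m)"
proof (induction m)
  case (Suc m)
  define R where "R = schur K m"
  have R: "psd R" using Suc by (simp add: R_def)
  have sym: "R i j = R j i" for i j by (rule psd_sym[OF R])
  have "0 \<le> (\<Sum>i\<in>I. \<Sum>j\<in>I. c i * c j * (R i j - R i m * R m j / R m m))" if "finite I" for I c
  proof -
    define b where "b = (\<Sum>i\<in>I. c i * R i m)"
    define a where "a = (\<Sum>i\<in>I. \<Sum>j\<in>I. c i * c j * R i j)"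
    have "(\<Sum>i\<in>I. \<Sum>j\<in>I. c i * c j * (R i j - R i m * R m j / R m m)) =
        a - (\<Sum>i\<in>I. \<Sum>j\<in>I. (c i * R i m) * (c j * R j m)) / R m m"
      unfolding a_def sum_divide_distrib sum_subtractf[symmetric]
    proof (intro sum.cong refl)
      fix i j
      show "c i * c j * (R i j - R i m * R m j / R m m) = c i * c j * R i j - c i * R i m * (c j * R j m) / R m m"
        unfolding sym[of m j] by (simp add: algebra_simps)
    qed
    also have "\<dots> = a - b\<^sup>2 / R m m"
      by (simp only: b_def power2_eq_square sum_product)
    also have "0 \<le> \<dots>"
    proof (cases "R m m = 0")
      case True
      then show ?thesis
        using psd_shift[OF R that, of c 0 m] unfolding a_def by simp
    next
      case False
      \<comment> \<open>\<open>- b / R m m\<close> minimises the polynomial, and the minimum is the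
        form of the Schur complement.\<close>
      have "0 \<le> a + 2 * (- b / R m m) * b + (- b / R m m)\<^sup>2 * R m m"
        unfolding a_def b_def by (rule psd_shift[OF R that])
      also have "\<dots> = a - b\<^sup>2 / R m m" using False by (simp add: field_simps power2_eq_square)
      finally show ?thesis .
    qed
    finally show ?thesis .
  qed
  moreover have "R i j - R i m * R m j / R m m = R j i - R j m * R m i / R m m" for i j
    unfolding sym[of i j] sym[of i m] sym[of j m] by (simp only: mult.commute)
  ultimately show ?case
    unfolding psd_def by (simp only: schur.simps R_def[symmetric]) blast
qed simp

lemma schur_zero: "psd K \<Longrightarrow> i < m \<or> j < m \<Longrightarrow> schur K m i j = 0"
proof (induction m arbitrary: i j)
  case (Suc m)
  have R: "psd (schur K m)" by (rule psd_schur[OF Suc.prems(1)])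
  have z: "schur K m i m = 0" if "schur K m m m = 0" for i
    using psd_diag_zero[OF R that, of "\<lambda>_. 1" "{i}"] by simp
  show ?case
    using Suc.IH[OF Suc.prems(1)] Suc.prems(2) z psd_sym[OF R]
    by (cases "schur K m m m = 0") (auto simp: less_Suc_eq)
qed simp

definition cholesky :: "(nat \<Rightarrow> nat \<Rightarrow> real) \<Rightarrow> nat \<Rightarrow> nat \<Rightarrow> real" where
  "cholesky K i m = schur K m i m / sqrt (schur K m m m)"

lemma cholesky_zero: "psd K \<Longrightarrow> i < m \<Longrightarrow> cholesky K i m = 0"
  by (simp add: cholesky_def schur_zero)

text \<open>Each elimination step subtracts exactly the product of the entries of the next Cholesky
  column, so the partial sums telescope to \<open>K i j - schur K n i j\<close>; the remainder
  vanishes once row \<open>i\<close> has been eliminated.\<close>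

lemma cholesky_product:
  assumes "psd K" "i < n"
  shows "(\<Sum>m<n. cholesky K i m * cholesky K j m) = K i j"
proof -
  have "(\<Sum>m<n. cholesky K i m * cholesky K j m) = K i j - schur K n i j"
  proof (induction n)
    case (Suc n)
    have "sqrt (schur K n n n) * sqrt (schur K n n n) = schur K n n n"
      using psd_diag_nonneg[OF psd_schur[OF assms(1)]] by simp
    then have "cholesky K i n * cholesky K j n = schur K n i n * schur K n n j / schur K n n n"
      using psd_sym[OF psd_schur[OF assms(1)], of n n j] by (simp add: cholesky_def)
    then show ?case using Suc by simp
  qed simp
  then show ?thesis using schur_zero[OF assms(1)] assms(2) by simp
qed

section \<open>White noise and its linear images\<close>

definition white_noise :: "(nat \<Rightarrow> real) measure" where
  "white_noise = PiM UNIV (\<lambda>_. std_normal_distribution)"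

lemma prob_space_white_noise: "prob_space white_noise"
  unfolding white_noise_def by (intro prob_space_PiM prob_space_normal_density) simp

lemma measurable_white_noise[measurable]: "(\<lambda>\<omega>. \<omega> m) \<in> borel_measurable white_noise"
proof -
  have "(\<lambda>\<omega>. \<omega> m) \<in> white_noise \<rightarrow>\<^sub>M std_normal_distribution"
    unfolding white_noise_def by (rule measurable_component_singleton) simp
  then show ?thesis by simp
qed

lemma distr_white_noise: "distr white_noise borel (\<lambda>\<omega>. \<omega> m) = std_normal_distribution"
proof -
  have "distr white_noise std_normal_distribution (\<lambda>\<omega>. \<omega> m) = std_normal_distribution"
    unfolding white_noise_def by (rule distr_PiM_component) (auto intro: prob_space_normal_density)
  moreover have "distr white_noise std_normal_distribution (\<lambda>\<omega>. \<omega> m) = distr white_noise borel (\<lambda>\<omega>. \<omega> m)"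
    by (rule distr_cong) auto
  ultimately show ?thesis by simp
qed

lemma indep_vars_white_noise: "prob_space.indep_vars white_noise (\<lambda>_. borel) (\<lambda>m \<omega>. \<omega> m) UNIV"
proof -
  interpret prob_space white_noise by (rule prob_space_white_noise)
  have "sets (PiM UNIV (\<lambda>_. borel)) = sets white_noise"
    unfolding white_noise_def by (intro sets_PiM_cong) auto
  then have "distr white_noise (PiM UNIV (\<lambda>_. borel)) (\<lambda>\<omega>. \<omega>) = white_noise" by (rule distr_id2)
  then show ?thesis
    by (subst indep_vars_iff_distr_eq_PiM) (simp_all add: distr_white_noise restrict_UNIV, simp add: white_noise_def)
qed

text \<open>Since the factor is lower triangular, each variable is a finite combination of the noise
  and no series has to converge, although the family is infinite.\<close>

definition gaussian_seq :: "(nat \<Rightarrow> nat \<Rightarrow> real) \<Rightarrow> nat \<Rightarrow> (nat \<Rightarrow> real) \<Rightarrow> real" where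
  "gaussian_seq K i \<omega> = (\<Sum>m\<le>i. cholesky K i m * \<omega> m)"

lemma measurable_gaussian_seq[measurable]: "gaussian_seq K i \<in> borel_measurable white_noise"
  unfolding gaussian_seq_def[abs_def] by measurable

text \<open>Characteristic functions multiply over independent summands, and
  \<open>char_gaussian_law\<close> includes variance zero, so vanishing coefficients need no
  separate case.\<close>

lemma distr_white_noise_sum:
  "distr white_noise borel (\<lambda>\<omega>. \<Sum>m<n. a m * \<omega> m) = gaussian_law 0 (\<Sum>m<n. (a m)\<^sup>2)"
proof (rule Levy_uniqueness)
  interpret prob_space white_noise by (rule prob_space_white_noise)
  have v: "0 \<le> (\<Sum>m<n. (a m)\<^sup>2)" by (intro sum_nonneg) auto
  show "real_distribution (distr white_noise borel (\<lambda>\<omega>. \<Sum>m<n. a m * \<omega> m))"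
    by (intro real_distribution_distr) measurable
  show "real_distribution (gaussian_law 0 (\<Sum>m<n. (a m)\<^sup>2))"
    by (rule real_distribution_gaussian_law[OF v])
  show "char (distr white_noise borel (\<lambda>\<omega>. \<Sum>m<n. a m * \<omega> m)) = char (gaussian_law 0 (\<Sum>m<n. (a m)\<^sup>2))"
  proof
    fix t
    have "indep_vars (\<lambda>_. borel) (\<lambda>m \<omega>. a m * \<omega> m) {..<n}"
      by (rule indep_vars_compose2[OF indep_vars_subset[OF indep_vars_white_noise]]) auto
    then have "char (distr white_noise borel (\<lambda>\<omega>. \<Sum>m<n. a m * \<omega> m)) t =
        (\<Prod>m<n. char (distr white_noise borel (\<lambda>\<omega>. a m * \<omega> m)) t)"
      by (rule char_distr_sum)
    also have "\<dots> = (\<Prod>m<n. of_real (exp (- ((a m)\<^sup>2 * t\<^sup>2) / 2)))"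
    proof (rule prod.cong)
      fix m
      have "char (distr white_noise borel (\<lambda>\<omega>. a m * \<omega> m)) t = char (distr white_noise borel (\<lambda>\<omega>. \<omega> m)) (a m * t)"
        unfolding char_def by (simp add: integral_distr mult_ac)
      then show "char (distr white_noise borel (\<lambda>\<omega>. a m * \<omega> m)) t = of_real (exp (- ((a m)\<^sup>2 * t\<^sup>2) / 2))"
        by (simp add: distr_white_noise char_std_normal_distribution power_mult_distrib)
    qed simp
    also have "\<dots> = of_real (exp (- ((\<Sum>m<n. (a m)\<^sup>2) * t\<^sup>2) / 2))"
      by (simp add: sum_distrib_right sum_divide_distrib exp_sum flip: sum_negf of_real_prod)
    finally show "char (distr white_noise borel (\<lambda>\<omega>. \<Sum>m<n. a m * \<omega> m)) t = char (gaussian_law 0 (\<Sum>m<n. (a m)\<^sup>2)) t"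
      by (simp add: char_gaussian_law[OF v])
  qed
qed

lemma distr_gaussian_seq_sum:
  assumes "psd K" "finite S"
  shows "distr white_noise borel (\<lambda>\<omega>. \<Sum>x\<in>S. c x * gaussian_seq K (j x) \<omega>) =
    gaussian_law 0 (\<Sum>x\<in>S. \<Sum>y\<in>S. c x * c y * K (j x) (j y))"
proof -
  \<comment> \<open>A common length for all the sums; \<open>cholesky_zero\<close> allows each of
    them to be padded up to it.\<close>
  obtain n where n: "\<And>x. x \<in> S \<Longrightarrow> j x < n"
    using finite_nat_set_iff_bounded[of "j ` S"] assms(2) by auto
  define a where "a m = (\<Sum>x\<in>S. c x * cholesky K (j x) m)" for m
  have "gaussian_seq K (j x) \<omega> = (\<Sum>m<n. cholesky K (j x) m * \<omega> m)" if "x \<in> S" for x \<omega>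
    unfolding gaussian_seq_def using n[OF that] cholesky_zero[OF assms(1)]
    by (intro sum.mono_neutral_left) auto
  then have "(\<Sum>x\<in>S. c x * gaussian_seq K (j x) \<omega>) = (\<Sum>x\<in>S. \<Sum>m<n. c x * (cholesky K (j x) m * \<omega> m))" for \<omega>
    by (simp add: sum_distrib_left)
  also have "\<dots> \<omega> = (\<Sum>m<n. a m * \<omega> m)" for \<omega>
    unfolding a_def sum_distrib_right by (subst sum.swap) (simp add: mult.assoc)
  finally have "distr white_noise borel (\<lambda>\<omega>. \<Sum>x\<in>S. c x * gaussian_seq K (j x) \<omega>) = gaussian_law 0 (\<Sum>m<n. (a m)\<^sup>2)"
    by (simp only: distr_white_noise_sum)
  also have "(\<Sum>m<n. (a m)\<^sup>2) = (\<Sum>m<n. \<Sum>x\<in>S. \<Sum>y\<in>S. c x * c y * (cholesky K (j x) m * cholesky K (j y) m))"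
    unfolding a_def power2_eq_square sum_product by (intro sum.cong refl) (simp add: mult_ac)
  also have "\<dots> = (\<Sum>x\<in>S. \<Sum>y\<in>S. \<Sum>m<n. c x * c y * (cholesky K (j x) m * cholesky K (j y) m))"
    by (subst sum.swap) (intro sum.cong refl sum.swap)
  also have "\<dots> = (\<Sum>x\<in>S. \<Sum>y\<in>S. c x * c y * K (j x) (j y))"
    using n by (intro sum.cong refl) (simp add: cholesky_product[OF assms(1)] flip: sum_distrib_left)
  finally show ?thesis .
qed

lemma gaussian_tail_le:
  assumes X: "X \<in> borel_measurable M" and law: "distr M borel X = gaussian_law 0 v"
    and "0 \<le> v" "v \<le> a\<^sup>2" "0 < s"
  shows "measure M {\<omega>\<in>space M. s \<le> \<bar>X \<omega>\<bar>} \<le> 2 * exp (- s\<^sup>2 / (2 * a\<^sup>2))"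
proof -
  have "X -` {x. s \<le> \<bar>x\<bar>} \<inter> space M = {\<omega>\<in>space M. s \<le> \<bar>X \<omega>\<bar>}" by auto
  then have "measure M {\<omega>\<in>space M. s \<le> \<bar>X \<omega>\<bar>} = measure (distr M borel X) {x. s \<le> \<bar>x\<bar>}"
    using X by (subst measure_distr) auto
  then show ?thesis using gaussian_law_tail[OF assms(3-5)] by (simp add: law)
qed

lemma pos_def_kernel_onD:
  fixes I :: "nat set"
  assumes "pos_def_kernel_on A K" "finite I" "\<And>i. i \<in> I \<Longrightarrow> x i \<in> A"
  shows "0 \<le> (\<Sum>i\<in>I. \<Sum>j\<in>I. c i * c j * K (x i) (x j))"
  using assms unfolding pos_def_kernel_on_def by simp

lemma pos_def_kernel_on_comp:
  assumes "pos_def_kernel_on A K" "\<And>x. x \<in> S \<Longrightarrow> u x \<in> A"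
  shows "pos_def_kernel_on S (\<lambda>x y. K (u x) (u y))"
  using assms pos_def_kernel_onD[OF assms(1)] unfolding pos_def_kernel_on_def[of S]
  by (intro conjI ballI allI impI) (auto simp: pos_def_kernel_on_def)

lemma pos_def_kernel_sum_nonneg:
  assumes "pos_def_kernel_on A k" "finite S" "S \<subseteq> A"
  shows "0 \<le> (\<Sum>x\<in>S. \<Sum>y\<in>S. w x * w y * k x y)"
proof -
  obtain h where h: "bij_betw h {0..<card S} S" using ex_bij_betw_nat_finite[OF assms(2)] by blast
  have "(\<Sum>x\<in>S. \<Sum>y\<in>S. w x * w y * k x y) =
      (\<Sum>i\<in>{0..<card S}. \<Sum>j\<in>{0..<card S}. w (h i) * w (h j) * k (h i) (h j))"
    by (simp only: sum.reindex_bij_betw[OF h, symmetric])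
  also have "0 \<le> \<dots>"
  proof -
    have "h i \<in> A" if "i \<in> {0..<card S}" for i
      using bij_betwE[OF h] that assms(3) by blast
    then show ?thesis
      using pos_def_kernel_onD[OF assms(1), of "{0..<card S}" h "\<lambda>i. w (h i)"] by simp
  qed
  finally show ?thesis .
qed

section \<open>Gaussian fields with continuous paths\<close>

context compact_index begin

lemma proj_in_skel: "x \<in> D \<Longrightarrow> proj k x \<in> skel"
  by (rule net_in_skel[OF proj_in_net])

lemma skel_nonempty: "skel \<noteq> {}"
  using D_nonempty proj_in_skel by blast

text \<open>Used twice: for the family on \<open>skel\<close> driven by white noise, before any path
  is continuous, and for the coordinates under the finished limit law. The expression in
  \<open>inc\<close> is the variance of an increment.\<close>

lemma gaussian_field_subgaussian:
  assumes pd: "pos_def_kernel_on D k"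
    and inc: "\<And>x y. x \<in> D \<Longrightarrow> y \<in> D \<Longrightarrow> k x x - 2 * k x y + k y y \<le> (c * dist x y)\<^sup>2"
    and val: "\<And>x. x \<in> D \<Longrightarrow> k x x \<le> b\<^sup>2"
    and meas: "\<And>u. u \<in> skel \<Longrightarrow> (\<lambda>\<omega>. X \<omega> u) \<in> borel_measurable M"
    and law: "\<And>S w. finite S \<Longrightarrow> S \<subseteq> skel \<Longrightarrow>
      distr M borel (\<lambda>\<omega>. \<Sum>x\<in>S. w x * X \<omega> x) = gaussian_law 0 (\<Sum>x\<in>S. \<Sum>y\<in>S. w x * w y * k x y)"
    and "0 \<le> c"
  shows "subgaussian_increments M X c" "subgaussian_values M X b"
proof -
  have pos: "0 \<le> (\<Sum>x\<in>S. \<Sum>y\<in>S. w x * w y * k x y)" if "finite S" "S \<subseteq> skel" for S w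
    by (rule pos_def_kernel_sum_nonneg[OF pd that(1)]) (use that skel_subset in auto)
  show "subgaussian_increments M X c"
    unfolding subgaussian_increments_def
  proof (intro conjI ballI allI impI meas)
    fix u v and a s :: real assume uv: "u \<in> skel" "v \<in> skel" and "0 < a" "0 < s" "dist u v \<le> (a::real)"
    show "measure M {\<omega>\<in>space M. s \<le> \<bar>X \<omega> u - X \<omega> v\<bar>} \<le> 2 * exp (- s\<^sup>2 / (2 * (c * a)\<^sup>2))"
    proof (cases "u = v")
      case True
      then show ?thesis using \<open>0 < s\<close> by simp
    next
      case False
      define w where "w x = (if x = u then 1 else - 1 :: real)" for x
      have sum: "(\<Sum>x\<in>{u, v}. w x * X \<omega> x) = X \<omega> u - X \<omega> v" for \<omega>
        using False by (simp add: w_def)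
      have sym: "k v u = k u v" using pd uv skel_subset unfolding pos_def_kernel_on_def by blast
      have var: "(\<Sum>x\<in>{u, v}. \<Sum>y\<in>{u, v}. w x * w y * k x y) = k u u - 2 * k u v + k v v"
        using False sym by (simp add: w_def)
      have "k u u - 2 * k u v + k v v \<le> (c * dist u v)\<^sup>2" using inc uv skel_subset by blast
      also have "\<dots> \<le> (c * a)\<^sup>2"
        using \<open>0 \<le> c\<close> \<open>dist u v \<le> a\<close> by (intro power_mono mult_left_mono) auto
      finally have le: "k u u - 2 * k u v + k v v \<le> (c * a)\<^sup>2" .
      have "distr M borel (\<lambda>\<omega>. X \<omega> u - X \<omega> v) = gaussian_law 0 (k u u - 2 * k u v + k v v)"
        using law[of "{u, v}" w] uv by (simp only: sum var) simp
      moreover have "0 \<le> k u u - 2 * k u v + k v v"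
        using pos[of "{u, v}" w] uv by (simp only: var) simp
      ultimately show ?thesis
        using meas uv le \<open>0 < s\<close> by (intro gaussian_tail_le) auto
    qed
  qed
  show "subgaussian_values M X b"
    unfolding subgaussian_values_def
  proof (intro ballI allI impI)
    fix u s assume u: "u \<in> skel" and "0 < (s::real)"
    show "measure M {\<omega>\<in>space M. s \<le> \<bar>X \<omega> u\<bar>} \<le> 2 * exp (- s\<^sup>2 / (2 * b\<^sup>2))"
      using law[of "{u}" "\<lambda>_. 1"] pos[of "{u}" "\<lambda>_. 1"] u val[of u] skel_subset \<open>0 < s\<close> meas[OF u]
      by (intro gaussian_tail_le) auto
  qed
qed

text \<open>The laws of the extension at points of \<open>D\<close> are limits of those at their
  grid points. Characteristic functions converge on one side by almost sure convergence and
  domination, on the other by continuity of the kernel.\<close>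

lemma ex_continuous_gaussian_field:
  assumes pd: "pos_def_kernel_on D k"
    and cont: "continuous_on (D \<times> D) (\<lambda>(x, y). k x y)"
    and inc: "\<And>x y. x \<in> D \<Longrightarrow> y \<in> D \<Longrightarrow> k x x - 2 * k x y + k y y \<le> (c * dist x y)\<^sup>2"
    and "0 < c"
  shows "\<exists>\<mu>. sets \<mu> = sets (borel_CD D) \<and> prob_space \<mu> \<and> (\<forall>S w. finite S \<longrightarrow> S \<subseteq> D \<longrightarrow>
    distr \<mu> borel (\<lambda>f. \<Sum>x\<in>S. w x * f x) = gaussian_law 0 (\<Sum>x\<in>S. \<Sum>y\<in>S. w x * w y * k x y))"
proof -
  interpret W: prob_space white_noise by (rule prob_space_white_noise)
  define K where "K i j = k (from_nat_into skel i) (from_nat_into skel j)" for i j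
  have e: "from_nat_into skel i \<in> D" for i
    using from_nat_into[OF skel_nonempty] skel_subset by blast
  have psd: "psd K"
    using pd e unfolding psd_def pos_def_kernel_on_def K_def by simp
  define X where "X \<omega> u = gaussian_seq K (to_nat_on skel u) \<omega>" for \<omega> u
  have X[measurable]: "(\<lambda>\<omega>. X \<omega> u) \<in> borel_measurable white_noise" for u
    unfolding X_def by measurable
  \<comment> \<open>Stated along a map \<open>u\<close> because distinct points of \<open>S\<close>
    may share a grid point.\<close>
  have law: "distr white_noise borel (\<lambda>\<omega>. \<Sum>x\<in>S. w x * X \<omega> (u x)) =
      gaussian_law 0 (\<Sum>x\<in>S. \<Sum>y\<in>S. w x * w y * k (u x) (u y))"
    if "finite S" "\<And>x. x \<in> S \<Longrightarrow> u x \<in> skel" for S :: "'a set" and u w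
    unfolding X_def distr_gaussian_seq_sum[OF psd that(1)]
    by (rule arg_cong[of _ _ "gaussian_law 0"]) (simp add: K_def that(2) countable_skel)
  have pos: "0 \<le> (\<Sum>x\<in>S. \<Sum>y\<in>S. w x * w y * k (u x) (u y))"
    if "finite S" "\<And>x. x \<in> S \<Longrightarrow> u x \<in> D" for S :: "'a set" and u w
    by (rule pos_def_kernel_sum_nonneg[OF pos_def_kernel_on_comp[OF pd that(2)] that(1)]) auto
  have "bounded ((\<lambda>(x, y). k x y) ` (D \<times> D))"
    by (intro compact_imp_bounded compact_continuous_image cont compact_Times compact_D)
  then obtain B where B: "\<And>x y. x \<in> D \<Longrightarrow> y \<in> D \<Longrightarrow> \<bar>k x y\<bar> \<le> B" by (auto simp: bounded_iff)
  have sg: "subgaussian_increments white_noise X c"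
  proof (rule gaussian_field_subgaussian(1)[OF pd inc])
    show "k x x \<le> (sqrt B)\<^sup>2" if "x \<in> D" for x using B[OF that that] by simp
  qed (use law[of _ "\<lambda>x. x"] \<open>0 < c\<close> in auto)
  have meas_tame: "{\<omega>\<in>space white_noise. \<exists>m. tame m (X \<omega>)} \<in> sets white_noise"
    by (intro sets.sets_Collect_countable_Ex sets_tame X)
  \<comment> \<open>The value 0 off the event of tameness puts every path, not just almost every
    one, into \<open>CD D\<close>.\<close>
  define Z where "Z \<omega> = restrict (\<lambda>x. if \<exists>m. tame m (X \<omega>) then lim_proj (X \<omega>) x else 0) D" for \<omega>
  have Z_CD: "Z \<omega> \<in> CD D" for \<omega>
  proof (cases "\<exists>m. tame m (X \<omega>)")
    case True
    then obtain m where "tame m (X \<omega>)" by blast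
    then have "continuous_on D (lim_proj (X \<omega>))" by (intro continuous_on_equi equi_lim_proj)
    then show ?thesis using True by (simp add: Z_def CD_def cong: continuous_on_cong)
  qed (simp add: Z_def CD_def cong: continuous_on_cong)
  have Zx[measurable]: "(\<lambda>\<omega>. Z \<omega> x) \<in> borel_measurable white_noise" if "x \<in> D" for x
  proof -
    have "(\<lambda>\<omega>. lim_proj (X \<omega>) x) \<in> borel_measurable white_noise"
      unfolding lim_proj_def by (rule borel_measurable_lim_metric) (rule X)
    then have "(\<lambda>\<omega>. if \<exists>m. tame m (X \<omega>) then lim_proj (X \<omega>) x else 0) \<in> borel_measurable white_noise"
      using meas_tame by (intro measurable_If) auto
    then show ?thesis using that by (simp add: Z_def)
  qed
  have Z: "Z \<in> white_noise \<rightarrow>\<^sub>M borel_CD D"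
    using Z_CD Zx by (rule measurable_borel_CDI)
  define \<mu> where "\<mu> = distr white_noise (borel_CD D) Z"
  have "distr \<mu> borel (\<lambda>f. \<Sum>x\<in>S. w x * f x) = gaussian_law 0 (\<Sum>x\<in>S. \<Sum>y\<in>S. w x * w y * k x y)"
    if S: "finite S" "S \<subseteq> D" for S w
  proof -
    define V where "V n = (\<Sum>x\<in>S. \<Sum>y\<in>S. w x * w y * k (proj n x) (proj n y))" for n
    define v where "v = (\<Sum>x\<in>S. \<Sum>y\<in>S. w x * w y * k x y)"
    have v: "0 \<le> v" unfolding v_def by (rule pos_def_kernel_sum_nonneg[OF pd S])
    have V: "0 \<le> V n" for n unfolding V_def using S by (intro pos) (auto intro: proj_in_D)
    have "(\<lambda>n. k (proj n x) (proj n y)) \<longlonglongrightarrow> k x y" if "x \<in> D" "y \<in> D" for x y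
      using continuous_on_tendsto_compose[OF cont tendsto_Pair[OF proj_tendsto[OF that(1)] proj_tendsto[OF that(2)]]]
        that by (simp add: proj_in_D)
    then have V_lim: "V \<longlonglongrightarrow> v"
      unfolding V_def[abs_def] v_def using S by (intro tendsto_sum tendsto_mult tendsto_const) auto
    have [measurable]: "(\<lambda>\<omega>. \<Sum>x\<in>S. w x * Z \<omega> x) \<in> borel_measurable white_noise"
      using S by (intro borel_measurable_sum borel_measurable_times borel_measurable_const Zx) auto
    have [measurable]: "(\<lambda>f. \<Sum>x\<in>S. w x * f x) \<in> borel_measurable (borel_CD D)"
      using S by (intro borel_measurable_sum borel_measurable_times borel_measurable_const measurable_eval_borel_CD) auto
    have lawZ: "distr \<mu> borel (\<lambda>f. \<Sum>x\<in>S. w x * f x) = distr white_noise borel (\<lambda>\<omega>. \<Sum>x\<in>S. w x * Z \<omega> x)"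
      unfolding \<mu>_def using Z by (subst distr_distr) (auto simp: o_def)
    show ?thesis
      unfolding lawZ v_def[symmetric]
    proof (rule Levy_uniqueness)
      show "real_distribution (gaussian_law 0 v)" by (rule real_distribution_gaussian_law[OF v])
      show "real_distribution (distr white_noise borel (\<lambda>\<omega>. \<Sum>x\<in>S. w x * Z \<omega> x))"
        by (rule W.real_distribution_distr) measurable
      show "char (distr white_noise borel (\<lambda>\<omega>. \<Sum>x\<in>S. w x * Z \<omega> x)) = char (gaussian_law 0 v)"
      proof
        fix t
        have "AE \<omega> in white_noise. (\<lambda>n. iexp (t * (\<Sum>x\<in>S. w x * X \<omega> (proj n x)))) \<longlonglongrightarrow> iexp (t * (\<Sum>x\<in>S. w x * Z \<omega> x))"
          using AE_ex_tame[OF prob_space_white_noise sg \<open>0 < c\<close>]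
        proof (rule AE_mp, intro AE_I2 impI)
          fix \<omega> assume "\<exists>m. tame m (X \<omega>)"
          then have "(\<lambda>n. X \<omega> (proj n x)) \<longlonglongrightarrow> Z \<omega> x" if "x \<in> S" for x
            using that S(2) by (auto simp: Z_def intro: tame_tendsto)
          then show "(\<lambda>n. iexp (t * (\<Sum>x\<in>S. w x * X \<omega> (proj n x)))) \<longlonglongrightarrow> iexp (t * (\<Sum>x\<in>S. w x * Z \<omega> x))"
            by (intro tendsto_intros) auto
        qed
        then have "(\<lambda>n. CLINT \<omega>|white_noise. iexp (t * (\<Sum>x\<in>S. w x * X \<omega> (proj n x))))
            \<longlonglongrightarrow> (CLINT \<omega>|white_noise. iexp (t * (\<Sum>x\<in>S. w x * Z \<omega> x)))"
        proof (rule integral_dominated_convergence[where w = "\<lambda>_. 1", rotated 3])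
          show "AE \<omega> in white_noise. cmod (iexp (t * (\<Sum>x\<in>S. w x * X \<omega> (proj n x)))) \<le> 1" for n
            by (simp only: norm_exp_i_times order_refl eventually_True)
          show "(\<lambda>\<omega>. iexp (t * (\<Sum>x\<in>S. w x * Z \<omega> x))) \<in> borel_measurable white_noise" by measurable
          show "(\<lambda>\<omega>. iexp (t * (\<Sum>x\<in>S. w x * X \<omega> (proj n x)))) \<in> borel_measurable white_noise" for n
            by measurable
        qed simp
        moreover have "(CLINT \<omega>|white_noise. iexp (t * (\<Sum>x\<in>S. w x * X \<omega> (proj n x)))) = exp (- (V n * t\<^sup>2) / 2)" for n
        proof -
          have "distr white_noise borel (\<lambda>\<omega>. \<Sum>x\<in>S. w x * X \<omega> (proj n x)) = gaussian_law 0 (V n)"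
            unfolding V_def using S by (intro law) (auto intro: proj_in_skel)
          then have "char (distr white_noise borel (\<lambda>\<omega>. \<Sum>x\<in>S. w x * X \<omega> (proj n x))) t = exp (- (V n * t\<^sup>2) / 2)"
            by (simp add: char_gaussian_law[OF V])
          then show ?thesis unfolding char_def by (subst (asm) integral_distr) auto
        qed
        moreover have "(\<lambda>n. complex_of_real (exp (- (V n * t\<^sup>2) / 2))) \<longlonglongrightarrow> complex_of_real (exp (- (v * t\<^sup>2) / 2))"
          by (intro tendsto_intros V_lim) simp
        ultimately have "(CLINT \<omega>|white_noise. iexp (t * (\<Sum>x\<in>S. w x * Z \<omega> x))) = exp (- (v * t\<^sup>2) / 2)"
          by (simp only: LIMSEQ_unique)
        then show "char (distr white_noise borel (\<lambda>\<omega>. \<Sum>x\<in>S. w x * Z \<omega> x)) t = char (gaussian_law 0 v) t"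
          unfolding char_gaussian_law[OF v] unfolding char_def by (subst integral_distr) auto
      qed
    qed
  qed
  moreover have "sets \<mu> = sets (borel_CD D)" by (simp add: \<mu>_def)
  moreover have "prob_space \<mu>" unfolding \<mu>_def by (rule W.prob_space_distr[OF Z])
  ultimately show ?thesis by blast
qed

end

section \<open>Weak convergence from trigonometric polynomials\<close>

lemma (in prob_space) integral_diff_le:
  fixes F Q :: "'a \<Rightarrow> real"
  assumes F: "integrable M F" and Q: "integrable M Q" and G: "G \<in> sets M"
    and "0 \<le> a" "0 \<le> b" and a: "\<And>x. x \<in> G \<Longrightarrow> \<bar>F x - Q x\<bar> \<le> a" and b: "\<And>x. x \<in> space M \<Longrightarrow> \<bar>F x - Q x\<bar> \<le> b"
  shows "\<bar>integral\<^sup>L M F - integral\<^sup>L M Q\<bar> \<le> a + b * measure M (space M - G)"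
proof -
  have sets: "space M - G \<in> sets M" using G by auto
  have "\<bar>integral\<^sup>L M F - integral\<^sup>L M Q\<bar> = \<bar>\<integral>x. F x - Q x \<partial>M\<bar>"
    using F Q by simp
  also have "\<dots> \<le> (\<integral>x. \<bar>F x - Q x\<bar> \<partial>M)" by (rule integral_abs_bound)
  also have "\<dots> \<le> (\<integral>x. a + b * indicator (space M - G) x \<partial>M)"
  proof (rule integral_mono)
    show "integrable M (\<lambda>x. \<bar>F x - Q x\<bar>)" using F Q by simp
    show "integrable M (\<lambda>x. a + b * indicator (space M - G) x)"
      using sets by (intro Bochner_Integration.integrable_add integrable_mult_right integrable_real_indicator)
        (auto simp: emeasure_eq_measure)
    show "\<bar>F x - Q x\<bar> \<le> a + b * indicator (space M - G) x" if "x \<in> space M" for x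
      using a[of x] b[OF that] that \<open>0 \<le> a\<close> by (cases "x \<in> G") (auto simp: indicator_def)
  qed
  also have "\<dots> = a + b * measure M (space M - G)"
    using sets by (subst Bochner_Integration.integral_add) (auto simp: prob_space emeasure_eq_measure)
  finally show ?thesis .
qed

section \<open>Trigonometric polynomials on function space\<close>

context compact_index begin

text \<open>The phase \<open>\<theta>\<close> lets cosines do the work of sines as well, so that
  closure under products rests on a single addition formula.\<close>

inductive_set trig_poly :: "(('a \<Rightarrow> real) \<Rightarrow> real) set" where
  cos: "finite S \<Longrightarrow> S \<subseteq> D \<Longrightarrow> (\<lambda>f. cos (\<theta> + (\<Sum>x\<in>S. w x * f x))) \<in> trig_poly"
| add: "F \<in> trig_poly \<Longrightarrow> G \<in> trig_poly \<Longrightarrow> (\<lambda>f. F f + G f) \<in> trig_poly"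
| scale: "F \<in> trig_poly \<Longrightarrow> (\<lambda>f. r * F f) \<in> trig_poly"

lemma trig_poly_const: "(\<lambda>f. r) \<in> trig_poly"
  using trig_poly.scale[OF trig_poly.cos[of "{}" 0], of r] by simp

lemma trig_poly_cos_mult:
  assumes "finite S" "S \<subseteq> D" "finite S'" "S' \<subseteq> D"
  shows "(\<lambda>f. cos (\<theta> + (\<Sum>x\<in>S. w x * f x)) * cos (\<theta>' + (\<Sum>x\<in>S'. w' x * f x))) \<in> trig_poly"
proof -
  define v v' where "v x = (if x \<in> S then w x else 0)" and "v' x = (if x \<in> S' then w' x else 0)" for x
  have v: "(\<Sum>x\<in>S. w x * f x) = (\<Sum>x\<in>S \<union> S'. v x * f x)" for f
    using assms by (intro sum.mono_neutral_cong_left) (auto simp: v_def)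
  have v': "(\<Sum>x\<in>S'. w' x * f x) = (\<Sum>x\<in>S \<union> S'. v' x * f x)" for f
    using assms by (intro sum.mono_neutral_cong_left) (auto simp: v'_def)
  have "cos (\<theta> + (\<Sum>x\<in>S. w x * f x)) * cos (\<theta>' + (\<Sum>x\<in>S'. w' x * f x)) =
     1/2 * cos ((\<theta> - \<theta>') + (\<Sum>x\<in>S \<union> S'. (v x - v' x) * f x)) +
     1/2 * cos ((\<theta> + \<theta>') + (\<Sum>x\<in>S \<union> S'. (v x + v' x) * f x))" for f
    unfolding v v' cos_times_cos
    by (simp add: algebra_simps sum.distrib sum_subtractf add_divide_distrib)
  moreover have "(\<lambda>f. 1/2 * cos ((\<theta> - \<theta>') + (\<Sum>x\<in>S \<union> S'. (v x - v' x) * f x)) +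
     1/2 * cos ((\<theta> + \<theta>') + (\<Sum>x\<in>S \<union> S'. (v x + v' x) * f x))) \<in> trig_poly"
    using assms by (intro trig_poly.intros) auto
  ultimately show ?thesis by simp
qed

lemma trig_poly_mult:
  assumes "F \<in> trig_poly" "G \<in> trig_poly"
  shows "(\<lambda>f. F f * G f) \<in> trig_poly"
  using assms(1)
proof (induction rule: trig_poly.induct)
  case c: (cos S \<theta> w)
  from assms(2) show ?case
  proof (induction rule: trig_poly.induct)
    case (cos S' \<theta>' w')
    then show ?case using c by (intro trig_poly_cos_mult)
  next
    case (add F G)
    then show ?case unfolding distrib_left by (intro trig_poly.add)
  next
    case (scale F r)
    then show ?case unfolding mult.left_commute[of _ r] by (intro trig_poly.scale)
  qed
next
  case (add F H)
  then show ?case unfolding distrib_right by (intro trig_poly.add)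
next
  case (scale F r)
  then show ?case unfolding mult.assoc by (intro trig_poly.scale)
qed

lemma trig_poly_compose_polynomial:
  fixes p :: "real \<Rightarrow> real"
  assumes "real_polynomial_function p" "T \<in> trig_poly"
  shows "(\<lambda>f. p (T f)) \<in> trig_poly"
  using assms(1)
proof (induction rule: real_polynomial_function.induct)
  case (linear h)
  then have "h y = h 1 * y" for y
    using linear_scale[OF bounded_linear.linear, of h y 1] by simp
  then have "(\<lambda>f. h (T f)) = (\<lambda>f. h 1 * T f)" by (intro ext)
  then show ?case using trig_poly.scale[OF assms(2), of "h 1"] by (simp only:)
qed (use trig_poly_const trig_poly.add trig_poly_mult in auto)

lemma trig_poly_continuous: "T \<in> trig_poly \<Longrightarrow> continuous_on UNIV T"
proof (induction rule: trig_poly.induct)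
  case (cos S \<theta> w)
  show ?case
    by (intro continuous_on_cos continuous_on_add continuous_on_const continuous_on_sum continuous_on_mult
        continuous_on_product_coordinates)
qed (auto intro: continuous_intros)

lemma trig_poly_bounded: "T \<in> trig_poly \<Longrightarrow> \<exists>C. \<forall>f. \<bar>T f\<bar> \<le> C"
proof (induction rule: trig_poly.induct)
  case (add F G)
  then obtain C C' where "\<And>f. \<bar>F f\<bar> \<le> C" "\<And>f. \<bar>G f\<bar> \<le> C'" by blast
  then have "\<bar>F f + G f\<bar> \<le> C + C'" for f using abs_triangle_ineq[of "F f" "G f"] by (meson add_mono order_trans)
  then show ?case by blast
next
  case (scale F r)
  then obtain C where "\<And>f. \<bar>F f\<bar> \<le> C" by blast
  then have "\<bar>r * F f\<bar> \<le> \<bar>r\<bar> * C" for f by (simp add: abs_mult mult_left_mono)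
  then show ?case by blast
qed (use abs_cos_le_one in blast)

lemma trig_poly_measurable: "T \<in> trig_poly \<Longrightarrow> T \<in> borel_measurable (borel_CD D)"
proof (induction rule: trig_poly.induct)
  case (cos S \<theta> w)
  then have [measurable]: "(\<lambda>f. \<Sum>x\<in>S. w x * f x) \<in> borel_measurable (borel_CD D)"
    by (intro borel_measurable_sum borel_measurable_times borel_measurable_const measurable_eval_borel_CD) auto
  show ?case by measurable
qed (auto intro: borel_measurable_add borel_measurable_times)

lemma trig_poly_integrable:
  assumes "prob_space \<nu>" "sets \<nu> = sets (borel_CD D)" "T \<in> trig_poly"
  shows "integrable \<nu> T"
proof -
  interpret prob_space \<nu> by fact
  obtain C where "\<And>f. \<bar>T f\<bar> \<le> C" using trig_poly_bounded[OF assms(3)] by blast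
  moreover have "T \<in> borel_measurable \<nu>"
    using trig_poly_measurable[OF assms(3)] measurable_cong_sets[OF assms(2) refl] by blast
  ultimately show ?thesis by (intro integrable_const_bound[of _ C]) auto
qed

lemma trig_poly_dense:
  assumes "continuous_on (CK m R) F" "0 < e"
  shows "\<exists>T\<in>trig_poly. \<forall>f\<in>CK m R. \<bar>F f - T f\<bar> < e"
proof -
  interpret function_ring_on trig_poly "CK m R"
  proof
    fix f g assume fg: "f \<in> CK m R" "g \<in> CK m R" "f \<noteq> g"
    then obtain x where x: "f x \<noteq> g x" by blast
    \<comment> \<open>Off \<open>D\<close> both functions are \<open>undefined\<close>, so the
      coordinate that separates them lies in \<open>D\<close>.\<close>
    then have xD: "x \<in> D" using fg by (auto simp: CK_def extensional_def)
    \<comment> \<open>This frequency puts the two values half a period apart: the cosine below is 1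
      at \<open>f\<close> and -1 at \<open>g\<close>.\<close>
    define w where "w = pi / (g x - f x)"
    have T: "(\<lambda>h. cos (- w * f x + (\<Sum>x\<in>{x}. w * h x))) \<in> trig_poly"
      using xD by (intro trig_poly.cos) auto
    have "w * (g x - f x) = pi" using x by (simp add: w_def)
    then have "w * g x - w * f x = pi" by (simp only: right_diff_distrib)
    then have "- w * f x + w * g x = pi" by simp
    then have "cos (- w * f x + (\<Sum>x\<in>{x}. w * g x)) = - 1" by simp
    moreover have "cos (- w * f x + (\<Sum>x\<in>{x}. w * f x)) = 1" by simp
    ultimately show "\<exists>T\<in>trig_poly. T f \<noteq> T g" using T by (intro bexI[OF _ T]) simp
  qed (auto intro: trig_poly.add trig_poly_mult trig_poly_const compact_CK
      continuous_on_subset[OF trig_poly_continuous])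
  show ?thesis using Stone_Weierstrass_basic[OF assms] by simp
qed

text \<open>The trigonometric polynomial is clamped to the range of \<open>F\<close>, so that its size off the compact
  set does not matter; the clamping is then undone by a polynomial approximation.\<close>

lemma trig_poly_approx:
  assumes F: "bounded_cont_CD D F" and B: "0 \<le> B" "\<And>f. f \<in> CD D \<Longrightarrow> \<bar>F f\<bar> \<le> B" and "0 < e"
  shows "\<exists>Q\<in>trig_poly. (\<forall>f\<in>CK m R. \<bar>F f - Q f\<bar> \<le> e) \<and> (\<forall>f\<in>CD D. \<bar>F f - Q f\<bar> \<le> 2 * B + e)"
proof -
  obtain T where T: "T \<in> trig_poly" "\<And>f. f \<in> CK m R \<Longrightarrow> \<bar>F f - T f\<bar> < e / 2"
    using trig_poly_dense[OF continuous_on_CK[OF F] half_gt_zero[OF \<open>0 < e\<close>]] by blast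
  obtain C where C: "\<And>f. \<bar>T f\<bar> \<le> C" using trig_poly_bounded[OF T(1)] by blast
  define h where "h y = max (- B) (min B y)" for y :: real
  have "continuous_on {- C..C} h" unfolding h_def by (intro continuous_intros)
  then obtain p where p: "real_polynomial_function p" "\<And>y. y \<in> {- C..C} \<Longrightarrow> \<bar>h y - p y\<bar> < e / 2"
    using Stone_Weierstrass_real_polynomial_function[of "{- C..C}" h "e / 2"] \<open>0 < e\<close> by auto
  \<comment> \<open>\<open>p\<close> approximates the clamp on the whole range of \<open>T\<close>,
    hence at every function, inside the compact set or not.\<close>
  have hp: "\<bar>h (T f) - p (T f)\<bar> < e / 2" for f using p(2)[of "T f"] C[of f] by (simp add: abs_le_iff minus_le_iff)
  have "\<bar>F f - p (T f)\<bar> \<le> e" if f: "f \<in> CK m R" for f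
  proof -
    have "\<bar>F f\<bar> \<le> B" using B(2) f CK_subset_CD by blast
    \<comment> \<open>\<open>F f\<close> already lies between \<open>- B\<close> and
      \<open>B\<close>, and clamping never moves a number away from a point of that
      interval.\<close>
    then have "\<bar>F f - h (T f)\<bar> \<le> \<bar>F f - T f\<bar>" unfolding h_def by linarith
    then show ?thesis using T(2)[OF f] hp[of f] by linarith
  qed
  moreover have "\<bar>F f - p (T f)\<bar> \<le> 2 * B + e" if f: "f \<in> CD D" for f
  proof -
    have "\<bar>h (T f)\<bar> \<le> B" using B(1) unfolding h_def by linarith
    then show ?thesis using B(2)[OF f] hp[of f] \<open>0 < e\<close> by linarith
  qed
  ultimately show ?thesis
    using trig_poly_compose_polynomial[OF p(1) T(1)] by (intro bexI[of _ "\<lambda>f. p (T f)"] conjI ballI)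
qed

text \<open>The constants \<open>c\<close> and \<open>b\<close> are common to all the laws, so one
  compact set carries most of the mass of each of them, the limit included, and one trigonometric
  polynomial approximates \<open>F\<close> for all simultaneously.\<close>

lemma weak_conv_CD_if_trig_poly:
  assumes \<mu>s: "\<And>n. prob_space (\<mu>s n)" "\<And>n. sets (\<mu>s n) = sets (borel_CD D)"
    "\<And>n. subgaussian_increments (\<mu>s n) (\<lambda>f. f) c" "\<And>n. subgaussian_values (\<mu>s n) (\<lambda>f. f) b"
    and \<mu>: "prob_space \<mu>" "sets \<mu> = sets (borel_CD D)"
    "subgaussian_increments \<mu> (\<lambda>f. f) c" "subgaussian_values \<mu> (\<lambda>f. f) b"
    and "0 < c" "0 < b"
    and cos: "\<And>S w \<theta>. finite S \<Longrightarrow> S \<subseteq> D \<Longrightarrow> (\<lambda>n. \<integral>f. cos (\<theta> + (\<Sum>x\<in>S. w x * f x)) \<partial>(\<mu>s n))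
      \<longlonglongrightarrow> (\<integral>f. cos (\<theta> + (\<Sum>x\<in>S. w x * f x)) \<partial>\<mu>)"
  shows "weak_conv_CD D \<mu>s \<mu>"
  unfolding weak_conv_CD_def
proof (intro allI impI)
  fix F assume F: "bounded_cont_CD D F"
  then obtain B0 where B0: "\<And>f. f \<in> CD D \<Longrightarrow> \<bar>F f\<bar> \<le> B0" unfolding bounded_cont_CD_def by blast
  define B where "B = max B0 0"
  have B: "0 \<le> B" "\<And>f. f \<in> CD D \<Longrightarrow> \<bar>F f\<bar> \<le> B" using B0 by (force simp: B_def)+
  have Q_lim: "(\<lambda>n. integral\<^sup>L (\<mu>s n) Q) \<longlonglongrightarrow> integral\<^sup>L \<mu> Q" if "Q \<in> trig_poly" for Q
    using that
  proof (induction rule: trig_poly.induct)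
    case (cos S \<theta> w)
    then show ?case by (rule assms(11))
  next
    case (add F G)
    then show ?case
      by (simp add: trig_poly_integrable[OF \<mu>s(1,2)] trig_poly_integrable[OF \<mu>(1,2)] tendsto_add)
  next
    case (scale F r)
    then show ?case by (simp add: tendsto_mult_left)
  qed
  show "(\<lambda>n. integral\<^sup>L (\<mu>s n) F) \<longlonglongrightarrow> integral\<^sup>L \<mu> F"
  proof (rule LIMSEQ_I)
    fix r :: real assume "0 < r"
    \<comment> \<open>Replacing \<open>F\<close> by \<open>Q\<close> costs
      \<open>e + (2 * B + 1) * (e / 2)\<close> under each of two laws, and comparing the integrals
      of \<open>Q\<close> costs \<open>e\<close>: together \<open>(2 * B + 4) * e\<close>, which is
      less than \<open>r\<close>. The cap at 1 turns \<open>2 * B + e\<close> into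
      \<open>2 * B + 1\<close>.\<close>
    define e where "e = min 1 (r / (2 * B + 6))"
    have e: "0 < e" "e \<le> 1" using B(1) \<open>0 < r\<close> by (auto simp: e_def)
    have "e \<le> r / (2 * B + 6)" by (simp add: e_def)
    then have er: "2 * (e + (2 * B + 1) * (e / 2)) + 2 * e < r + e"
      using B(1) e(1) by (simp add: pos_le_divide_eq algebra_simps)
    obtain m R where mR: "0 < R" "escape_bound c b m R < e / 2"
      using ex_escape_bound_less[OF \<open>0 < c\<close> \<open>0 < b\<close>, of "e / 2"] e(1) by auto
    obtain Q where Q: "Q \<in> trig_poly" "\<And>f. f \<in> CK m R \<Longrightarrow> \<bar>F f - Q f\<bar> \<le> e"
      "\<And>f. f \<in> CD D \<Longrightarrow> \<bar>F f - Q f\<bar> \<le> 2 * B + e"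
      using trig_poly_approx[OF F B e(1)] by blast
    have approx: "\<bar>integral\<^sup>L \<nu> F - integral\<^sup>L \<nu> Q\<bar> \<le> e + (2 * B + 1) * (e / 2)"
      if \<nu>: "prob_space \<nu>" "sets \<nu> = sets (borel_CD D)"
        "subgaussian_increments \<nu> (\<lambda>f. f) c" "subgaussian_values \<nu> (\<lambda>f. f) b" for \<nu>
    proof -
      interpret prob_space \<nu> by (rule \<nu>(1))
      have space: "space \<nu> = CD D" using sets_eq_imp_space_eq[OF \<nu>(2)] by (simp add: space_borel_CD)
      obtain G where G: "G \<in> sets \<nu>" "measure \<nu> (space \<nu> - G) \<le> escape_bound c b m R" "\<And>f. f \<in> G \<Longrightarrow> f \<in> CK m R"
        using prob_escape_le[OF \<nu>(1,3,4) \<open>0 < c\<close> mR(1), of m] by (auto simp: space)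
      have "F \<in> borel_measurable \<nu>"
        using measurable_bounded_cont_CD[OF F] measurable_cong_sets[OF \<nu>(2) refl] by blast
      then have "integrable \<nu> F" using B(2) by (intro integrable_const_bound[of _ B]) (auto simp: space)
      then have "\<bar>integral\<^sup>L \<nu> F - integral\<^sup>L \<nu> Q\<bar> \<le> e + (2 * B + e) * measure \<nu> (space \<nu> - G)"
        using G Q B(1) e(1) space
        by (intro integral_diff_le trig_poly_integrable[OF \<nu>(1,2) Q(1)]) auto
      also have "\<dots> \<le> e + (2 * B + 1) * (e / 2)"
        using G(2) mR(2) e B(1) by (intro add_left_mono mult_mono) auto
      finally show ?thesis .
    qed
    obtain N where N: "\<And>n. n \<ge> N \<Longrightarrow> \<bar>integral\<^sup>L (\<mu>s n) Q - integral\<^sup>L \<mu> Q\<bar> < e"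
      using LIMSEQ_D[OF Q_lim[OF Q(1)] e(1)] by auto
    show "\<exists>N. \<forall>n\<ge>N. norm (integral\<^sup>L (\<mu>s n) F - integral\<^sup>L \<mu> F) < r"
    proof (intro exI allI impI)
      fix n assume "N \<le> n"
      from N[OF this] approx[OF \<mu>s(1,2,3,4), of n] approx[OF \<mu>] er
      show "norm (integral\<^sup>L (\<mu>s n) F - integral\<^sup>L \<mu> F) < r" by simp
    qed
  qed
qed

lemma subgaussian_distr:
  assumes X: "X \<in> M \<rightarrow>\<^sub>M borel_CD D"
  shows "subgaussian_increments M X c \<Longrightarrow> subgaussian_increments (distr M (borel_CD D) X) (\<lambda>f. f) c"
    "subgaussian_values M X b \<Longrightarrow> subgaussian_values (distr M (borel_CD D) X) (\<lambda>f. f) b"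
proof -
  have ev[measurable]: "(\<lambda>f. f u) \<in> borel_measurable (borel_CD D)" if "u \<in> skel" for u
    using that skel_subset by (intro measurable_eval_borel_CD) auto
  have *: "measure (distr M (borel_CD D) X) {f\<in>space (distr M (borel_CD D) X). P f} = measure M {\<omega>\<in>space M. P (X \<omega>)}"
    if "{f\<in>space (borel_CD D). P f} \<in> sets (borel_CD D)" for P
  proof -
    have "X -` {f\<in>space (borel_CD D). P f} \<inter> space M = {\<omega>\<in>space M. P (X \<omega>)}"
      using measurable_space[OF X] by auto
    then show ?thesis using measure_distr[OF X that] by simp
  qed
  show "subgaussian_increments (distr M (borel_CD D) X) (\<lambda>f. f) c" if "subgaussian_increments M X c"
    unfolding subgaussian_increments_def
  proof (intro conjI ballI allI impI)
    fix u v and a s :: real assume uv[measurable]: "u \<in> skel" "v \<in> skel" and as: "0 < a" "0 < s" "dist u v \<le> a"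
    show "measure (distr M (borel_CD D) X) {f\<in>space (distr M (borel_CD D) X). s \<le> \<bar>f u - f v\<bar>}
      \<le> 2 * exp (- s\<^sup>2 / (2 * (c * a)\<^sup>2))"
      by (subst *) (measurable, rule subgaussian_incrementsD[OF that uv as])
  qed simp
  show "subgaussian_values (distr M (borel_CD D) X) (\<lambda>f. f) b" if "subgaussian_values M X b"
    unfolding subgaussian_values_def
  proof (intro ballI allI impI)
    fix u and s :: real assume u[measurable]: "u \<in> skel" and s: "0 < s"
    show "measure (distr M (borel_CD D) X) {f\<in>space (distr M (borel_CD D) X). s \<le> \<bar>f u\<bar>}
      \<le> 2 * exp (- s\<^sup>2 / (2 * b\<^sup>2))"
      by (subst *) (measurable, use that u s in \<open>simp add: subgaussian_values_def\<close>)
  qed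
qed

end

section \<open>Normalised sums of bounded variables\<close>

text \<open>The sample runs over \<open>1..n\<close>, whereas \<open>central_limit_theorem\<close>
  sums over \<open>i < n\<close>.\<close>

lemma (in prob_space) indep_vars_Suc:
  assumes "indep_vars (\<lambda>_. N) X UNIV"
  shows "indep_vars (\<lambda>_. N) (\<lambda>i. X (Suc i)) UNIV"
proof -
  have X: "\<And>i. random_variable N (X i)" and ind: "indep_sets (\<lambda>i. {X i -` A \<inter> space M |A. A \<in> sets N}) UNIV"
    using assms by (auto simp: indep_vars_def2)
  have "indep_sets (\<lambda>i. {X (Suc i) -` A \<inter> space M |A. A \<in> sets N}) UNIV"
  proof (rule indep_setsI)
    fix A and J :: "nat set"
    assume J: "J \<noteq> {}" "finite J" "\<forall>j\<in>J. A j \<in> {X (Suc j) -` A \<inter> space M |A. A \<in> sets N}"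
    have "prob (\<Inter>j\<in>Suc ` J. A (j - 1)) = (\<Prod>j\<in>Suc ` J. prob (A (j - 1)))"
      by (rule indep_setsD[OF ind]) (use J in auto)
    then show "prob (\<Inter>j\<in>J. A j) = (\<Prod>j\<in>J. prob (A j))" by (simp add: prod.reindex)
  qed (use X in \<open>auto intro: measurable_sets\<close>)
  then show ?thesis using X by (simp add: indep_vars_def2)
qed

locale bounded_iid = prob_space M for M :: "'w measure" +
  fixes Y :: "nat \<Rightarrow> 'w \<Rightarrow> real" and a :: real
  assumes indep: "indep_vars (\<lambda>_. borel) Y UNIV"
    and ident: "\<And>i. distr M borel (Y i) = distr M borel (Y 0)"
    and bounded: "\<And>i \<omega>. \<omega> \<in> space M \<Longrightarrow> \<bar>Y i \<omega>\<bar> \<le> a"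
    and pos: "0 < a"
begin

text \<open>Index 0 is the generic copy that supplies the mean; the sample has the indices
  \<open>1..n\<close>. At \<open>n = 0\<close> the value is 0.\<close>

definition fluct :: "nat \<Rightarrow> 'w \<Rightarrow> real" where
  "fluct n \<omega> = sqrt (real n) * ((1 / real n) * (\<Sum>i\<in>{1..n}. Y i \<omega>) - expectation (Y 0))"

lemma fluct_eq: "fluct n \<omega> = ((\<Sum>i\<in>{1..n}. Y i \<omega>) - n * expectation (Y 0)) / sqrt n"
proof (cases "n = 0")
  case False
  have *: "r * ((1 / r\<^sup>2) * S - E) = (S - r\<^sup>2 * E) / r" if "0 < r" for r S E :: real
    using that by (simp add: field_simps power2_eq_square)
  show ?thesis using *[of "sqrt n"] False by (simp add: fluct_def)
qed (simp add: fluct_def)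

lemma Y_measurable[measurable]: "Y i \<in> borel_measurable M"
  using indep by (auto simp: indep_vars_def2)

lemma Y_integrable: "integrable M (Y i)"
  using bounded by (intro integrable_const_bound[of _ a]) auto

lemma Y_sq_integrable: "integrable M (\<lambda>\<omega>. (Y i \<omega>)\<^sup>2)"
  using bounded power_mono[of "\<bar>_\<bar>" a 2]
  by (intro integrable_const_bound[of _ "a\<^sup>2"]) auto

lemma fluct_measurable[measurable]: "fluct n \<in> borel_measurable M"
  unfolding fluct_def[abs_def] by measurable

text \<open>Hoeffding for \<open>n\<close> variables in an interval of length \<open>2 * a\<close>
  and a deviation of \<open>sqrt n * s\<close>: the sample size cancels, and the bound is uniform in
  \<open>n\<close>.\<close>

lemma fluct_tail:
  assumes "0 < s"
  shows "prob {\<omega>\<in>space M. s \<le> \<bar>fluct n \<omega>\<bar>} \<le> 2 * exp (- s\<^sup>2 / (2 * a\<^sup>2))"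
proof (cases "n = 0")
  case True
  then show ?thesis using assms by (simp add: fluct_def)
next
  case False
  interpret H: Hoeffding_ineq_iid M "{1..n}" Y "Y 0" "- a" a "expectation (Y 0)"
  proof unfold_locales
    show "AE \<omega> in M. Y 0 \<omega> \<in> {- a..a}"
      using bounded by (intro AE_I2) (auto simp: abs_le_iff minus_le_iff)
  qed (auto intro: indep_vars_subset[OF indep] ident)
  have n: "0 < real n" using False by simp
  have "{\<omega>\<in>space M. s \<le> \<bar>fluct n \<omega>\<bar>} =
      {\<omega>\<in>space M. sqrt n * s \<le> \<bar>(\<Sum>i\<in>{1..n}. Y i \<omega>) - card {1..n} * expectation (Y 0)\<bar>}"
    using n by (simp add: fluct_eq abs_divide pos_le_divide_eq mult.commute)
  also have "prob \<dots> \<le> 2 * exp (- 2 * (sqrt n * s)\<^sup>2 / (card {1..n} * (a - (- a))\<^sup>2))"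
    using assms pos False by (intro H.Hoeffding_ineq_abs_ge) auto
  also have "- 2 * (sqrt n * s)\<^sup>2 / (card {1..n} * (a - (- a))\<^sup>2) = - s\<^sup>2 / (2 * a\<^sup>2)"
    using n pos by (simp add: power_mult_distrib field_simps)
  finally show ?thesis .
qed

lemma expectation_Y: "expectation (Y i) = expectation (Y 0)"
proof -
  have "expectation (Y j) = (\<integral>x. x \<partial>distr M borel (Y j))" for j by (simp add: integral_distr)
  then show ?thesis by (simp only: ident[of i])
qed

lemma variance_Y: "variance (Y i) = variance (Y 0)"
proof -
  have "expectation (\<lambda>\<omega>. (Y j \<omega> - c)\<^sup>2) = (\<integral>x. (x - c)\<^sup>2 \<partial>distr M borel (Y j))" for j c
    by (simp add: integral_distr)
  then show ?thesis by (simp only: ident[of i] expectation_Y[of i])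
qed

text \<open>The central limit theorem requires positive variance. If the variance is zero, every
  \<open>Y i\<close> equals the mean almost surely and both sides are
  \<open>cos \<theta>\<close>.\<close>

lemma fluct_clt:
  "(\<lambda>n. expectation (\<lambda>\<omega>. cos (\<theta> + fluct n \<omega>))) \<longlonglongrightarrow> (\<integral>x. cos (\<theta> + x) \<partial>gaussian_law 0 (variance (Y 0)))"
proof (cases "variance (Y 0) = 0")
  case True
  have "AE \<omega> in M. Y i \<omega> = expectation (Y 0)" for i
  proof -
    have "integrable M (\<lambda>\<omega>. (Y i \<omega> - expectation (Y i))\<^sup>2)"
      using Y_integrable Y_sq_integrable by (auto simp: power2_diff)
    then have "AE \<omega> in M. (Y i \<omega> - expectation (Y i))\<^sup>2 = 0"
      using integral_nonneg_eq_0_iff_AE[of M "\<lambda>\<omega>. (Y i \<omega> - expectation (Y i))\<^sup>2"] variance_Y[of i] True by simp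
    then show ?thesis by (simp add: expectation_Y[of i])
  qed
  then have "AE \<omega> in M. \<forall>i. Y i \<omega> = expectation (Y 0)" by (simp add: AE_all_countable)
  then have "AE \<omega> in M. cos (\<theta> + fluct n \<omega>) = cos \<theta>" for n
    by (rule AE_mp) (auto simp: fluct_def)
  then have "expectation (\<lambda>\<omega>. cos (\<theta> + fluct n \<omega>)) = expectation (\<lambda>\<omega>. cos \<theta>)" for n
    by (intro integral_cong_AE) auto
  then show ?thesis unfolding True by (simp add: gaussian_law_def integral_return prob_space)
next
  case False
  define v where "v = variance (Y 0)"
  have v: "0 < v" using False by (simp add: v_def order_less_le)
  define U where "U n \<omega> = (\<Sum>i<n. Y (Suc i) \<omega> - expectation (Y 0)) / sqrt (n * (sqrt v)\<^sup>2)" for n \<omega>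
  have [measurable]: "U n \<in> borel_measurable M" for n unfolding U_def[abs_def] by measurable
  have clt: "weak_conv_m (\<lambda>n. distr M borel (U n)) std_normal_distribution"
    unfolding U_def
  proof (rule central_limit_theorem[where \<mu> = "distr M borel (Y 0)"])
    show "variance (Y (Suc n)) = (sqrt v)\<^sup>2" for n
      unfolding variance_Y[of "Suc n"] using v by (simp add: v_def)
    show "distr M borel (Y (Suc n)) = distr M borel (Y 0)" for n by (rule ident)
    show "expectation (Y (Suc n)) = expectation (Y 0)" for n by (rule expectation_Y)
  qed (use v in \<open>simp_all add: indep_vars_Suc[OF indep] Y_sq_integrable\<close>)
  have eq: "fluct n \<omega> = sqrt v * U n \<omega>" for n \<omega>
    using v by (simp add: fluct_eq U_def sum.atLeast1_atMost_eq sum_subtractf real_sqrt_mult)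
  have "(\<lambda>n. \<integral>x. cos (\<theta> + sqrt v * x) \<partial>distr M borel (U n)) \<longlonglongrightarrow> (\<integral>x. cos (\<theta> + sqrt v * x) \<partial>std_normal_distribution)"
    by (rule weak_conv_imp_integral_bdd_continuous_conv[OF _ _ clt, of _ 1])
      (auto intro: real_distribution_distr real_dist_normal_dist continuous_intros)
  moreover have "(\<integral>x. cos (\<theta> + sqrt v * x) \<partial>distr M borel (U n)) = expectation (\<lambda>\<omega>. cos (\<theta> + fluct n \<omega>))" for n
    by (subst integral_distr) (auto simp: eq)
  moreover have "(\<integral>x. cos (\<theta> + sqrt v * x) \<partial>std_normal_distribution) = (\<integral>x. cos (\<theta> + x) \<partial>gaussian_law 0 v)"
    using v by (subst gaussian_law_eq_distr) (auto simp: integral_distr)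
  ultimately show ?thesis by (simp add: v_def)
qed

end

section \<open>Independent bounded Lipschitz fields\<close>

text \<open>The bounds hold for every \<open>\<omega>\<close> in the space, so that each sample path
  is continuous and the normalised sums always take values in \<open>CD D\<close>.\<close>

locale lipschitz_iid_field = prob_space M + compact_index D
  for M :: "'w measure" and D :: "'a::euclidean_space set" +
  fixes b :: "nat \<Rightarrow> 'w \<Rightarrow> 'a \<Rightarrow> real" and L B :: real
  assumes indep: "indep_vars (\<lambda>_. PiM D (\<lambda>_. borel)) (\<lambda>i \<omega>. restrict (b i \<omega>) D) UNIV"
    and ident: "\<And>i. distr M (PiM D (\<lambda>_. borel)) (\<lambda>\<omega>. restrict (b i \<omega>) D)
      = distr M (PiM D (\<lambda>_. borel)) (\<lambda>\<omega>. restrict (b 0 \<omega>) D)"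
    and lipschitz: "\<And>i \<omega> x y. \<omega> \<in> space M \<Longrightarrow> x \<in> D \<Longrightarrow> y \<in> D \<Longrightarrow> \<bar>b i \<omega> x - b i \<omega> y\<bar> \<le> L * dist x y"
    and bounded: "\<And>i \<omega> x. \<omega> \<in> space M \<Longrightarrow> x \<in> D \<Longrightarrow> \<bar>b i \<omega> x\<bar> \<le> B"
    and L_pos: "0 < L" and B_pos: "0 < B"
begin

lemma restrict_b_measurable: "(\<lambda>\<omega>. restrict (b i \<omega>) D) \<in> M \<rightarrow>\<^sub>M PiM D (\<lambda>_. borel)"
  using indep by (auto simp: indep_vars_def2)

lemma b_measurable:
  assumes "x \<in> D"
  shows "(\<lambda>\<omega>. b i \<omega> x) \<in> borel_measurable M"
  using measurable_compose[OF restrict_b_measurable measurable_component_singleton[OF assms], of i] assms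
  by simp

lemma b_integrable: "x \<in> D \<Longrightarrow> integrable M (\<lambda>\<omega>. b i \<omega> x)"
  using bounded by (intro integrable_const_bound[of _ B] b_measurable) auto

lemma b_product_integrable:
  assumes "x \<in> D" "y \<in> D"
  shows "integrable M (\<lambda>\<omega>. b i \<omega> x * b i \<omega> y)"
proof (rule integrable_const_bound)
  show "AE \<omega> in M. norm (b i \<omega> x * b i \<omega> y) \<le> B * B"
    using bounded assms B_pos by (intro AE_I2) (auto simp: abs_mult intro!: mult_mono)
qed (intro borel_measurable_times b_measurable assms)

lemma b_continuous: "\<omega> \<in> space M \<Longrightarrow> continuous_on D (b i \<omega>)"
  using lipschitz L_pos
  by (intro lipschitz_on_continuous_on[of L]) (auto simp: lipschitz_on_def dist_real_def)

definition kernel :: "'a \<Rightarrow> 'a \<Rightarrow> real" where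
  "kernel x y = expectation (\<lambda>\<omega>. b 0 \<omega> x * b 0 \<omega> y) - expectation (\<lambda>\<omega>. b 0 \<omega> x) * expectation (\<lambda>\<omega>. b 0 \<omega> y)"

lemma kernel_sym: "kernel x y = kernel y x"
  by (simp add: kernel_def mult.commute)

lemma variance_sum:
  assumes "finite I" and p: "\<And>i. i \<in> I \<Longrightarrow> p i \<in> D"
  shows "variance (\<lambda>\<omega>. \<Sum>i\<in>I. w i * b 0 \<omega> (p i)) = (\<Sum>i\<in>I. \<Sum>j\<in>I. w i * w j * kernel (p i) (p j))"
proof -
  let ?X = "\<lambda>\<omega>. \<Sum>i\<in>I. w i * b 0 \<omega> (p i)"
  have sq: "(?X \<omega>)\<^sup>2 = (\<Sum>i\<in>I. \<Sum>j\<in>I. w i * w j * (b 0 \<omega> (p i) * b 0 \<omega> (p j)))" for \<omega>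
    by (simp add: power2_eq_square sum_product mult_ac)
  have int: "integrable M ?X" using p by (intro Bochner_Integration.integrable_sum integrable_mult_right b_integrable)
  have int2: "integrable M (\<lambda>\<omega>. (?X \<omega>)\<^sup>2)"
    unfolding sq using p by (intro Bochner_Integration.integrable_sum integrable_mult_right b_product_integrable)
  have "expectation (\<lambda>\<omega>. (?X \<omega>)\<^sup>2) = (\<Sum>i\<in>I. \<Sum>j\<in>I. w i * w j * expectation (\<lambda>\<omega>. b 0 \<omega> (p i) * b 0 \<omega> (p j)))"
    unfolding sq using p
    by (simp add: Bochner_Integration.integral_sum Bochner_Integration.integrable_sum b_product_integrable)
  moreover have "expectation ?X = (\<Sum>i\<in>I. w i * expectation (\<lambda>\<omega>. b 0 \<omega> (p i)))"
    using p by (simp add: Bochner_Integration.integral_sum b_integrable)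
  moreover have "(\<Sum>i\<in>I. w i * expectation (\<lambda>\<omega>. b 0 \<omega> (p i)))\<^sup>2 =
      (\<Sum>i\<in>I. \<Sum>j\<in>I. w i * w j * (expectation (\<lambda>\<omega>. b 0 \<omega> (p i)) * expectation (\<lambda>\<omega>. b 0 \<omega> (p j))))"
    by (simp add: power2_eq_square sum_product mult_ac)
  ultimately show ?thesis
    unfolding variance_eq[OF int int2] by (simp add: kernel_def right_diff_distrib sum_subtractf)
qed

lemma variance_le:
  fixes X :: "'w \<Rightarrow> real"
  assumes "X \<in> borel_measurable M" "\<And>\<omega>. \<omega> \<in> space M \<Longrightarrow> \<bar>X \<omega>\<bar> \<le> a"
  shows "variance X \<le> a\<^sup>2"
proof -
  have sq: "(X \<omega>)\<^sup>2 \<le> a\<^sup>2" if "\<omega> \<in> space M" for \<omega>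
    using assms(2)[OF that] by (metis abs_ge_zero power2_abs power_mono)
  have int: "integrable M X" using assms by (intro integrable_const_bound[of _ a]) auto
  have int2: "integrable M (\<lambda>\<omega>. (X \<omega>)\<^sup>2)" using assms sq by (intro integrable_const_bound[of _ "a\<^sup>2"]) auto
  have "variance X \<le> expectation (\<lambda>\<omega>. (X \<omega>)\<^sup>2)" by (simp add: variance_eq[OF int int2])
  also have "\<dots> \<le> expectation (\<lambda>_. a\<^sup>2)" by (intro integral_mono int2 sq) auto
  finally show ?thesis by (simp add: prob_space)
qed

lemma kernel_pos_def: "pos_def_kernel_on D kernel"
  unfolding pos_def_kernel_on_def
proof (intro conjI ballI allI impI kernel_sym)
  fix I :: "nat set" and c p assume "finite I" "\<forall>i\<in>I. p i \<in> D"
  then show "0 \<le> (\<Sum>i\<in>I. \<Sum>j\<in>I. c i * c j * kernel (p i) (p j))"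
    by (subst variance_sum[symmetric]) auto
qed

lemma kernel_increment:
  assumes "x \<in> D" "y \<in> D"
  shows "kernel x x - 2 * kernel x y + kernel y y \<le> (L * dist x y)\<^sup>2"
proof -
  \<comment> \<open>Indexing the two terms by \<open>bool\<close> instead of by the points keeps
    them apart when \<open>x = y\<close>.\<close>
  define w where "w i = (if i then 1 else - 1 :: real)" for i
  define p where "p i = (if i then x else y)" for i
  have "kernel x x - 2 * kernel x y + kernel y y = variance (\<lambda>\<omega>. \<Sum>i\<in>UNIV. w i * b 0 \<omega> (p i))"
    using assms kernel_sym[of x y] by (subst variance_sum) (auto simp: UNIV_bool w_def p_def)
  also have "(\<lambda>\<omega>. \<Sum>i\<in>UNIV. w i * b 0 \<omega> (p i)) = (\<lambda>\<omega>. b 0 \<omega> x - b 0 \<omega> y)"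
    by (auto simp: UNIV_bool w_def p_def)
  also have "variance \<dots> \<le> (L * dist x y)\<^sup>2"
    using lipschitz assms by (intro variance_le borel_measurable_diff b_measurable)
  finally show ?thesis .
qed

lemma kernel_diag_le:
  assumes "x \<in> D"
  shows "kernel x x \<le> B\<^sup>2"
proof -
  have "kernel x x = variance (\<lambda>\<omega>. \<Sum>i\<in>{()}. 1 * b 0 \<omega> x)"
    using assms by (subst variance_sum) auto
  also have "\<dots> \<le> B\<^sup>2"
    using bounded assms by (intro variance_le) (auto intro: b_measurable)
  finally show ?thesis .
qed

text \<open>The paths are continuous and bounded by \<open>B\<close>, so the moments pass to the
  limit by dominated convergence.\<close>

lemma kernel_continuous: "continuous_on (D \<times> D) (\<lambda>(x, y). kernel x y)"
proof (rule continuous_on_sequentiallyI)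
  fix u :: "nat \<Rightarrow> 'a \<times> 'a" and q assume u: "\<forall>n. u n \<in> D \<times> D" and q: "q \<in> D \<times> D" and lim: "u \<longlonglongrightarrow> q"
  have D: "fst (u n) \<in> D" "snd (u n) \<in> D" "fst q \<in> D" "snd q \<in> D" for n
    using u q by (auto simp: mem_Times_iff)
  have lim12: "(\<lambda>n. fst (u n)) \<longlonglongrightarrow> fst q" "(\<lambda>n. snd (u n)) \<longlonglongrightarrow> snd q"
    using lim by (auto intro: tendsto_intros)
  have b_lim: "(\<lambda>n. b 0 \<omega> (x n)) \<longlonglongrightarrow> b 0 \<omega> z"
    if "\<omega> \<in> space M" "x \<longlonglongrightarrow> z" "\<And>n. x n \<in> D" "z \<in> D" for \<omega> x z
    using continuous_on_tendsto_compose[OF b_continuous[OF that(1)] that(2)] that by auto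
  have E: "(\<lambda>n. expectation (\<lambda>\<omega>. b 0 \<omega> (x n))) \<longlonglongrightarrow> expectation (\<lambda>\<omega>. b 0 \<omega> z)"
    if "x \<longlonglongrightarrow> z" "\<And>n. x n \<in> D" "z \<in> D" for x z
  proof (rule integral_dominated_convergence[where w = "\<lambda>_. B"])
    show "AE \<omega> in M. (\<lambda>n. b 0 \<omega> (x n)) \<longlonglongrightarrow> b 0 \<omega> z" using that by (intro AE_I2 b_lim)
  qed (use that bounded in \<open>auto intro: b_measurable\<close>)
  have E2: "(\<lambda>n. expectation (\<lambda>\<omega>. b 0 \<omega> (fst (u n)) * b 0 \<omega> (snd (u n))))
      \<longlonglongrightarrow> expectation (\<lambda>\<omega>. b 0 \<omega> (fst q) * b 0 \<omega> (snd q))"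
  proof (rule integral_dominated_convergence[where w = "\<lambda>_. B * B"])
    show "AE \<omega> in M. (\<lambda>n. b 0 \<omega> (fst (u n)) * b 0 \<omega> (snd (u n))) \<longlonglongrightarrow> b 0 \<omega> (fst q) * b 0 \<omega> (snd q)"
      using D lim12 by (intro AE_I2 tendsto_mult b_lim)
    show "AE \<omega> in M. norm (b 0 \<omega> (fst (u n)) * b 0 \<omega> (snd (u n))) \<le> B * B" for n
      using bounded D B_pos by (intro AE_I2) (auto simp: abs_mult intro!: mult_mono)
  qed (use D in \<open>auto intro!: borel_measurable_times b_measurable\<close>)
  show "(\<lambda>n. case u n of (x, y) \<Rightarrow> kernel x y) \<longlonglongrightarrow> (case q of (x, y) \<Rightarrow> kernel x y)"
    unfolding kernel_def split_beta
    by (intro tendsto_diff tendsto_mult E E2 lim12 D)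
qed

definition field :: "nat \<Rightarrow> 'w \<Rightarrow> 'a \<Rightarrow> real" where
  "field n \<omega> = restrict (\<lambda>x. sqrt (real n) *
     ((1 / real n) * (\<Sum>i\<in>{1..n}. b i \<omega> x) - expectation (\<lambda>\<omega>'. b 0 \<omega>' x))) D"

text \<open>A finite linear functional is measurable for the product sigma-algebra, so independence
  and equality of laws descend from the fields to real variables. Increments, single values and the
  combinations of Cramer and Wold are all of this kind.\<close>

lemma bounded_iid_sum:
  assumes "finite I" and p: "\<And>i. i \<in> I \<Longrightarrow> p i \<in> D" and "0 < a"
    and a: "\<And>j \<omega>. \<omega> \<in> space M \<Longrightarrow> \<bar>\<Sum>i\<in>I. w i * b j \<omega> (p i)\<bar> \<le> a"
  shows "bounded_iid M (\<lambda>j \<omega>. \<Sum>i\<in>I. w i * b j \<omega> (p i)) a"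
proof -
  have \<phi>: "(\<lambda>f. \<Sum>i\<in>I. w i * f (p i)) \<in> borel_measurable (PiM D (\<lambda>_. borel))"
    using p by (intro borel_measurable_sum borel_measurable_times borel_measurable_const measurable_component_singleton)
  have eq: "(\<Sum>i\<in>I. w i * b j \<omega> (p i)) = (\<Sum>i\<in>I. w i * restrict (b j \<omega>) D (p i))" for j \<omega>
    using p by (intro sum.cong) auto
  show ?thesis
  proof
    show "indep_vars (\<lambda>_. borel) (\<lambda>j \<omega>. \<Sum>i\<in>I. w i * b j \<omega> (p i)) UNIV"
      unfolding eq by (rule indep_vars_compose2[OF indep \<phi>])
    show "distr M borel (\<lambda>\<omega>. \<Sum>i\<in>I. w i * b j \<omega> (p i)) = distr M borel (\<lambda>\<omega>. \<Sum>i\<in>I. w i * b 0 \<omega> (p i))" for j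
    proof -
      have "distr M borel (\<lambda>\<omega>. \<Sum>i\<in>I. w i * b j \<omega> (p i)) =
          distr (distr M (PiM D (\<lambda>_. borel)) (\<lambda>\<omega>. restrict (b j \<omega>) D)) borel (\<lambda>f. \<Sum>i\<in>I. w i * f (p i))" for j
        unfolding eq by (subst distr_distr[OF \<phi> restrict_b_measurable]) (simp add: o_def)
      then show ?thesis by (simp only: ident[of j])
    qed
  qed (use assms in auto)
qed

text \<open>Centring and scaling are linear, hence a linear functional of the field is a
  one-dimensional fluctuation, to which the tail bound and the limit theorem for
  \<open>fluct\<close> apply.\<close>

lemma field_sum:
  assumes "bounded_iid M (\<lambda>j \<omega>. \<Sum>i\<in>I. w i * b j \<omega> (p i)) a"
    and "finite I" and p: "\<And>i. i \<in> I \<Longrightarrow> p i \<in> D"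
  shows "(\<Sum>i\<in>I. w i * field n \<omega> (p i)) = bounded_iid.fluct M (\<lambda>j \<omega>. \<Sum>i\<in>I. w i * b j \<omega> (p i)) n \<omega>"
proof -
  have "expectation (\<lambda>\<omega>. \<Sum>i\<in>I. w i * b 0 \<omega> (p i)) = (\<Sum>i\<in>I. w i * expectation (\<lambda>\<omega>. b 0 \<omega> (p i)))"
    using p by (simp add: Bochner_Integration.integral_sum b_integrable)
  moreover have "(\<Sum>j\<in>{1..n}. \<Sum>i\<in>I. w i * b j \<omega> (p i)) = (\<Sum>i\<in>I. w i * (\<Sum>j\<in>{1..n}. b j \<omega> (p i)))"
    unfolding sum_distrib_left by (rule sum.swap)
  moreover have "(\<Sum>i\<in>I. w i * field n \<omega> (p i)) = (\<Sum>i\<in>I. w i * (sqrt (real n) *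
     ((1 / real n) * (\<Sum>j\<in>{1..n}. b j \<omega> (p i)) - expectation (\<lambda>\<omega>'. b 0 \<omega>' (p i)))))"
    using p by (intro sum.cong) (auto simp: field_def)
  ultimately show ?thesis
    unfolding bounded_iid.fluct_def[OF assms(1)]
    by (simp only: sum_distrib_left sum_subtractf right_diff_distrib mult_ac)
qed

lemma field_in_CD:
  assumes "\<omega> \<in> space M"
  shows "field n \<omega> \<in> CD D"
proof -
  have "continuous_on D (\<lambda>x. expectation (\<lambda>\<omega>. b 0 \<omega> x))"
  proof (rule continuous_on_sequentiallyI)
    fix u z assume u: "\<forall>n. u n \<in> D" and z: "z \<in> D" "u \<longlonglongrightarrow> z"
    show "(\<lambda>n. expectation (\<lambda>\<omega>. b 0 \<omega> (u n))) \<longlonglongrightarrow> expectation (\<lambda>\<omega>. b 0 \<omega> z)"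
    proof (rule integral_dominated_convergence[where w = "\<lambda>_. B"])
      show "AE \<omega> in M. (\<lambda>n. b 0 \<omega> (u n)) \<longlonglongrightarrow> b 0 \<omega> z"
        using u z by (intro AE_I2 continuous_on_tendsto_compose[OF b_continuous]) auto
    qed (use u z bounded in \<open>auto intro: b_measurable\<close>)
  qed
  then have "continuous_on D (\<lambda>x. sqrt (real n) *
     ((1 / real n) * (\<Sum>i\<in>{1..n}. b i \<omega> x) - expectation (\<lambda>\<omega>'. b 0 \<omega>' x)))"
    using assms by (intro continuous_intros b_continuous)
  then show ?thesis by (simp add: CD_def field_def cong: continuous_on_cong)
qed

lemma field_eval_measurable:
  assumes "x \<in> D"
  shows "(\<lambda>\<omega>. field n \<omega> x) \<in> borel_measurable M"
proof -
  have [measurable]: "(\<lambda>\<omega>. b i \<omega> x) \<in> borel_measurable M" for i using assms by (rule b_measurable)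
  show ?thesis using assms by (simp add: field_def)
qed

lemma field_measurable: "field n \<in> M \<rightarrow>\<^sub>M borel_CD D"
  using field_in_CD field_eval_measurable by (rule measurable_borel_CDI)

lemma field_subgaussian_increments: "subgaussian_increments M (field n) L"
  unfolding subgaussian_increments_def
proof (intro conjI ballI allI impI field_eval_measurable)
  fix u v and a s :: real
  assume uv: "u \<in> skel" "v \<in> skel" and as: "0 < a" "0 < s" "dist u v \<le> a"
  define w where "w i = (if i then 1 else - 1 :: real)" for i
  define p where "p i = (if i then u else v)" for i
  have p: "p i \<in> D" for i using uv skel_subset by (auto simp: p_def)
  have sum: "(\<Sum>i\<in>UNIV. w i * f (p i)) = f u - f v" for f :: "'a \<Rightarrow> real"
    by (simp add: UNIV_bool w_def p_def)
  have "\<bar>b j \<omega> u - b j \<omega> v\<bar> \<le> L * a" if "\<omega> \<in> space M" for j \<omega>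
  proof -
    have "\<bar>b j \<omega> u - b j \<omega> v\<bar> \<le> L * dist u v" using that uv skel_subset by (intro lipschitz) auto
    also have "\<dots> \<le> L * a" using L_pos as by (intro mult_left_mono) auto
    finally show ?thesis .
  qed
  then have iid: "bounded_iid M (\<lambda>j \<omega>. \<Sum>i\<in>UNIV. w i * b j \<omega> (p i)) (L * a)"
    using p as L_pos by (intro bounded_iid_sum) (auto simp: sum)
  show "prob {\<omega>\<in>space M. s \<le> \<bar>field n \<omega> u - field n \<omega> v\<bar>} \<le> 2 * exp (- s\<^sup>2 / (2 * (L * a)\<^sup>2))"
    using bounded_iid.fluct_tail[OF iid as(2), of n] field_sum[OF iid _ p, of n] by (simp add: sum)
qed (use skel_subset in auto)

lemma field_subgaussian_values: "subgaussian_values M (field n) B"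
  unfolding subgaussian_values_def
proof (intro ballI allI impI)
  fix u and s :: real assume u: "u \<in> skel" and s: "0 < s"
  have uD: "u \<in> D" using u skel_subset by auto
  have iid: "bounded_iid M (\<lambda>j \<omega>. \<Sum>i\<in>{()}. 1 * b j \<omega> u) B"
    using uD B_pos bounded by (intro bounded_iid_sum) auto
  show "prob {\<omega>\<in>space M. s \<le> \<bar>field n \<omega> u\<bar>} \<le> 2 * exp (- s\<^sup>2 / (2 * B\<^sup>2))"
    using bounded_iid.fluct_tail[OF iid s, of n] field_sum[OF iid, of n] uD by simp
qed

lemma field_cos_tendsto:
  assumes S: "finite S" "S \<subseteq> D"
  shows "(\<lambda>n. expectation (\<lambda>\<omega>. cos (\<theta> + (\<Sum>x\<in>S. w x * field n \<omega> x)))) \<longlonglongrightarrow>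
    (\<integral>x. cos (\<theta> + x) \<partial>gaussian_law 0 (\<Sum>x\<in>S. \<Sum>y\<in>S. w x * w y * kernel x y))"
proof -
  \<comment> \<open>The added 1 keeps the bound positive even if all weights vanish.\<close>
  have iid: "bounded_iid M (\<lambda>j \<omega>. \<Sum>x\<in>S. w x * b j \<omega> x) ((\<Sum>x\<in>S. \<bar>w x\<bar> * B) + 1)"
  proof (rule bounded_iid_sum[where p = "\<lambda>x. x"])
    have "0 \<le> (\<Sum>x\<in>S. \<bar>w x\<bar> * B)" using B_pos by (intro sum_nonneg) auto
    then show "0 < (\<Sum>x\<in>S. \<bar>w x\<bar> * B) + 1" by linarith
    fix j \<omega> assume \<omega>: "\<omega> \<in> space M"
    have "\<bar>\<Sum>x\<in>S. w x * b j \<omega> x\<bar> \<le> (\<Sum>x\<in>S. \<bar>w x * b j \<omega> x\<bar>)" by (rule sum_abs)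
    also have "\<dots> \<le> (\<Sum>x\<in>S. \<bar>w x\<bar> * B)"
      using \<omega> S(2) bounded by (intro sum_mono) (auto simp: abs_mult intro!: mult_left_mono)
    finally show "\<bar>\<Sum>x\<in>S. w x * b j \<omega> x\<bar> \<le> (\<Sum>x\<in>S. \<bar>w x\<bar> * B) + 1" by linarith
  qed (use S in auto)
  have p: "\<And>x. x \<in> S \<Longrightarrow> x \<in> D" using S by auto
  have "variance (\<lambda>\<omega>. \<Sum>x\<in>S. w x * b 0 \<omega> x) = (\<Sum>x\<in>S. \<Sum>y\<in>S. w x * w y * kernel x y)"
    using variance_sum[where p = "\<lambda>x. x", OF S(1) p] by simp
  moreover have "(\<Sum>x\<in>S. w x * field n \<omega> x) = bounded_iid.fluct M (\<lambda>j \<omega>. \<Sum>x\<in>S. w x * b j \<omega> x) n \<omega>" for n \<omega>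
    using field_sum[where p = "\<lambda>x. x", OF iid S(1) p] by simp
  ultimately show ?thesis
    using bounded_iid.fluct_clt[OF iid, of \<theta>] by (simp only:)
qed

theorem field_clt:
  "\<exists>\<mu>. sets \<mu> = sets (borel_CD D) \<and> prob_space \<mu> \<and> gaussian_field_law D \<mu> \<and>
    (\<forall>x\<in>D. integrable \<mu> (\<lambda>f. f x) \<and> (\<integral>f. f x \<partial>\<mu>) = 0) \<and>
    (\<forall>x\<in>D. \<forall>y\<in>D. integrable \<mu> (\<lambda>f. f x * f y) \<and> (\<integral>f. f x * f y \<partial>\<mu>) = kernel x y) \<and>
    weak_conv_CD D (\<lambda>n. distr M (borel_CD D) (field n)) \<mu>"
proof -
  obtain \<mu> where \<mu>: "sets \<mu> = sets (borel_CD D)" "prob_space \<mu>"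
    and law: "\<And>S w. finite S \<Longrightarrow> S \<subseteq> D \<Longrightarrow>
      distr \<mu> borel (\<lambda>f. \<Sum>x\<in>S. w x * f x) = gaussian_law 0 (\<Sum>x\<in>S. \<Sum>y\<in>S. w x * w y * kernel x y)"
    using ex_continuous_gaussian_field[OF kernel_pos_def kernel_continuous kernel_increment L_pos] by blast
  have pos: "0 \<le> (\<Sum>x\<in>S. \<Sum>y\<in>S. w x * w y * kernel x y)" if "finite S" "S \<subseteq> D" for S w
    by (rule pos_def_kernel_sum_nonneg[OF kernel_pos_def that])
  have eval: "(\<lambda>f. f x) \<in> borel_measurable \<mu>" if "x \<in> D" for x
    using measurable_eval_borel_CD[OF that] measurable_cong_sets[OF \<mu>(1) refl] by blast
  have lin: "(\<lambda>f. \<Sum>x\<in>S. w x * f x) \<in> borel_measurable \<mu>" if "S \<subseteq> D" for S w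
    using that by (intro borel_measurable_sum borel_measurable_times borel_measurable_const eval) auto
  have gauss: "gaussian_field_law D \<mu>"
    unfolding gaussian_field_law_def using law pos by blast
  have mom: "integrable \<mu> (\<lambda>f. \<Sum>x\<in>S. w x * f x)" "(\<integral>f. (\<Sum>x\<in>S. w x * f x) \<partial>\<mu>) = 0"
    "integrable \<mu> (\<lambda>f. (\<Sum>x\<in>S. w x * f x)\<^sup>2)"
    "(\<integral>f. (\<Sum>x\<in>S. w x * f x)\<^sup>2 \<partial>\<mu>) = (\<Sum>x\<in>S. \<Sum>y\<in>S. w x * w y * kernel x y)"
    if S: "finite S" "S \<subseteq> D" for S w
    using gaussian_law_moments[OF pos[OF S, of w]] unfolding law[OF S, symmetric]
    by (simp_all add: integrable_distr_eq[OF lin[OF S(2)]] integral_distr[OF lin[OF S(2)]])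
  have mean: "integrable \<mu> (\<lambda>f. f x) \<and> (\<integral>f. f x \<partial>\<mu>) = 0" if "x \<in> D" for x
    using mom(1,2)[of "{x}" "\<lambda>_. 1"] that by simp
  have sq: "integrable \<mu> (\<lambda>f. (f x)\<^sup>2)" "(\<integral>f. (f x)\<^sup>2 \<partial>\<mu>) = kernel x x" if "x \<in> D" for x
    using mom(3,4)[of "{x}" "\<lambda>_. 1"] that by simp_all
  have cov: "integrable \<mu> (\<lambda>f. f x * f y) \<and> (\<integral>f. f x * f y \<partial>\<mu>) = kernel x y" if xy: "x \<in> D" "y \<in> D" for x y
  \<comment> \<open>For \<open>x = y\<close> the set \<open>{x, y}\<close> would collapse to one
    point, and the variance of a single coordinate is used instead.\<close>
  proof (cases "x = y")
    case True
    then show ?thesis using sq[OF xy(1)] by (simp add: power2_eq_square)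
  next
    case False
    have plus: "integrable \<mu> (\<lambda>f. (f x + f y)\<^sup>2)"
      "(\<integral>f. (f x + f y)\<^sup>2 \<partial>\<mu>) = kernel x x + 2 * kernel x y + kernel y y"
      using mom(3,4)[of "{x, y}" "\<lambda>_. 1"] xy False kernel_sym[of y x] by simp_all
    \<comment> \<open>Polarisation: mixed moments follow from second moments of sums, which are
      those of one-dimensional Gaussian laws.\<close>
    have eq: "f x * f y = ((f x + f y)\<^sup>2 - (f x)\<^sup>2 - (f y)\<^sup>2) / 2" for f :: "'a \<Rightarrow> real"
      by (simp add: power2_sum)
    show ?thesis
      unfolding eq using plus sq[OF xy(1)] sq[OF xy(2)] by simp
  qed
  \<comment> \<open>The limit inherits the constants of the sums because its covariance is that of a
    single field.\<close>
  have sg: "subgaussian_increments \<mu> (\<lambda>f. f) L" "subgaussian_values \<mu> (\<lambda>f. f) B"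
    using gaussian_field_subgaussian[OF kernel_pos_def kernel_increment kernel_diag_le, of "\<lambda>f. f" \<mu>]
      eval law L_pos skel_subset by (auto simp: subset_iff)
  have "weak_conv_CD D (\<lambda>n. distr M (borel_CD D) (field n)) \<mu>"
  proof (rule weak_conv_CD_if_trig_poly[OF _ _ _ _ \<mu>(2,1) sg L_pos B_pos])
    fix n
    show "prob_space (distr M (borel_CD D) (field n))" by (rule prob_space_distr[OF field_measurable])
    show "subgaussian_increments (distr M (borel_CD D) (field n)) (\<lambda>f. f) L"
      "subgaussian_values (distr M (borel_CD D) (field n)) (\<lambda>f. f) B"
      by (rule subgaussian_distr[OF field_measurable], rule field_subgaussian_increments field_subgaussian_values)+
  next
    fix S w \<theta> assume S: "finite S" "S \<subseteq> D"
    have "(\<integral>f. cos (\<theta> + (\<Sum>x\<in>S. w x * f x)) \<partial>\<mu>) =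
        (\<integral>x. cos (\<theta> + x) \<partial>gaussian_law 0 (\<Sum>x\<in>S. \<Sum>y\<in>S. w x * w y * kernel x y))"
      unfolding law[OF S, symmetric] by (subst integral_distr[OF lin[OF S(2)]]) auto
    moreover have "(\<integral>f. cos (\<theta> + (\<Sum>x\<in>S. w x * f x)) \<partial>distr M (borel_CD D) (field n)) =
        expectation (\<lambda>\<omega>. cos (\<theta> + (\<Sum>x\<in>S. w x * field n \<omega> x)))" for n
      using S by (intro integral_distr[OF field_measurable] trig_poly_measurable trig_poly.cos)
    ultimately show "(\<lambda>n. \<integral>f. cos (\<theta> + (\<Sum>x\<in>S. w x * f x)) \<partial>distr M (borel_CD D) (field n))
        \<longlonglongrightarrow> (\<integral>f. cos (\<theta> + (\<Sum>x\<in>S. w x * f x)) \<partial>\<mu>)"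
      using field_cos_tendsto[OF S] by simp
  qed simp
  then show ?thesis using \<mu> gauss mean cov by blast
qed

end

section \<open>Oriented distance functions\<close>

text \<open>The two distance functions contribute Lipschitz constant 1 each, and this includes empty
  sets, for which \<open>infdist\<close> is constantly 0.\<close>

lemma oriented_dist_lipschitz: "\<bar>oriented_dist D A x - oriented_dist D A y\<bar> \<le> 2 * dist x y"
  using infdist_triangle_abs[of x A y] infdist_triangle_abs[of x "D - A" y]
  unfolding oriented_dist_def by linarith

lemma infdist_le_diameter:
  assumes "bounded D" "A \<subseteq> D" "x \<in> D"
  shows "infdist x A \<le> diameter D"
proof (cases "A = {}")
  case True
  then show ?thesis using diameter_ge_0[OF assms(1)] by (simp add: infdist_def)
next
  case False
  then obtain a where "a \<in> A" by blast
  then show ?thesis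
    using infdist_le[of a A x] diameter_bounded_bound[OF assms(1,3), of a] assms(2) by auto
qed

lemma oriented_dist_bounded:
  assumes "bounded D" "A \<subseteq> D" "x \<in> D"
  shows "\<bar>oriented_dist D A x\<bar> \<le> diameter D"
  using infdist_le_diameter[OF assms] infdist_le_diameter[OF assms(1) _ assms(3), of "D - A"]
    infdist_nonneg[of x A] infdist_nonneg[of x "D - A"]
  unfolding oriented_dist_def by (auto simp: abs_le_iff)

theorem mainTheorem10:
  fixes M :: "'w measure" and D :: "'a::euclidean_space set" and A :: "nat \<Rightarrow> 'w \<Rightarrow> 'a set"
    and x0 :: 'a
  assumes "prob_space M"
    and "compact D"
    and "\<And>i. random_closed_set M D (A i)"
    and "\<And>i. AE \<omega> in M. rel_boundary D (A i \<omega>) \<noteq> {}"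
    and "prob_space.indep_vars M (\<lambda>_. PiM D (\<lambda>_. borel))
           (\<lambda>i \<omega>. restrict (oriented_dist D (A i \<omega>)) D) UNIV"
    and "\<And>i. distr M (PiM D (\<lambda>_. borel)) (\<lambda>\<omega>. restrict (oriented_dist D (A i \<omega>)) D)
             = distr M (PiM D (\<lambda>_. borel)) (\<lambda>\<omega>. restrict (oriented_dist D (A 0 \<omega>)) D)"
    and "x0 \<in> D"
    and "integrable M (\<lambda>\<omega>. (oriented_dist D (A 0 \<omega>) x0)\<^sup>2)"
  shows "let Zn = (\<lambda>(n::nat) \<omega>. restrict (\<lambda>x. sqrt (real n) *
                     ((1 / real n) * (\<Sum>i\<in>{1..n}. oriented_dist D (A i \<omega>) x)
                      - (\<integral>\<omega>'. oriented_dist D (A 0 \<omega>') x \<partial>M))) D)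
         in (\<forall>n. Zn n \<in> M \<rightarrow>\<^sub>M borel_CD D) \<and>
            (\<exists>\<mu>. sets \<mu> = sets (borel_CD D) \<and> prob_space \<mu> \<and>
               gaussian_field_law D \<mu> \<and>
               (\<forall>x\<in>D. integrable \<mu> (\<lambda>f. f x) \<and> (\<integral>f. f x \<partial>\<mu>) = 0) \<and>
               (\<forall>x\<in>D. \<forall>y\<in>D. integrable \<mu> (\<lambda>f. f x * f y) \<and>
                  (\<integral>f. f x * f y \<partial>\<mu>)
                  = (\<integral>\<omega>. oriented_dist D (A 0 \<omega>) x * oriented_dist D (A 0 \<omega>) y \<partial>M)
                    - (\<integral>\<omega>. oriented_dist D (A 0 \<omega>) x \<partial>M) * (\<integral>\<omega>. oriented_dist D (A 0 \<omega>) y \<partial>M)) \<and>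
               weak_conv_CD D (\<lambda>n. distr M (borel_CD D) (Zn n)) \<mu>)"
proof -
  interpret prob_space M by fact
  interpret lipschitz_iid_field M D "\<lambda>i \<omega>. oriented_dist D (A i \<omega>)" 2 "diameter D + 1"
  proof
    fix i \<omega> x assume "\<omega> \<in> space M" "x \<in> D"
    then show "\<bar>oriented_dist D (A i \<omega>) x\<bar> \<le> diameter D + 1"
      using oriented_dist_bounded[OF compact_imp_bounded[OF assms(2)], of "A i \<omega>" x] assms(3)[of i]
      by (auto simp: random_closed_set_def)
  next
    \<comment> \<open>The diameter vanishes when \<open>D\<close> is a single point, whereas the
      subgaussian constant has to be positive.\<close>
    show "0 < diameter D + 1"
      using diameter_ge_0[OF compact_imp_bounded[OF assms(2)]] by linarith
  \<comment> \<open>The point \<open>x0\<close> witnesses that \<open>D\<close> is nonempty.\<close>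
  qed (use assms oriented_dist_lipschitz in auto)
  show ?thesis
    unfolding Let_def field_def[symmetric] kernel_def[symmetric]
    using field_measurable field_clt by blast
qed

end
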